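(* Let $n\ge1$, let $R=K[[x_1,\dots,x_n]]$, let $I\subset R$ be an ideal, and let $A=R/I$ be an Artinian Gorenstein local ring with Hilbert function $\{1,n,n,1\}$. Then $A$ is canonically graded, i.e. $A$ is isomorphic as a $K$-algebra to its associated graded ring $gr_{\mathfrak m}(A)$.
   Context: $K$ is an algebraically closed field of characteristic zero. For $A=R/I$ of finite length with maximal ideal $\mathfrak m$, the associated graded ring is $gr_{\mathfrak m}(A)=\bigoplus_{i\ge0}\mathfrak m^i/\mathfrak m^{i+1}\simeq K[x_1,\dots,x_n]/I^*$, where $I^*$ is the homogeneous ideal generated by the initial forms (lowest degree homogeneous components) of the elements of $I$. Since $A$ is Artinian, $gr_{\mathfrak m}(A)$ is naturally identified with the local ring $R/I^*R$. The Hilbert function is $HF_A(i)=\dim_K(\mathfrak m^i/\mathfrak m^{i+1})$; $HF_A=\{1,n,n,1\}$ lists its values for $i=0,1,2,3$, with value $0$ for $i\ge4$. $A$ is Gorenstein if $\dim_K(0:\mathfrak m)=1$. *)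

theory Defs
  imports
    "HOL-Algebra.QuotRing"
    "HOL-Algebra.Ideal_Product"
    "HOL-Library.Cardinality"
    "Jordan_Normal_Form.VS_Connect"
begin

text \<open>
  Algebras over a field are records of type \<open>('k, 'a) module\<close>, as in the locale
  \<^locale>\<open>algebra\<close>. The ground field is a type \<open>'k\<close>, turned into a ring record
  by \<open>class_ring\<close>; dimensions are those of the locale \<^locale>\<open>vectorspace\<close>.
\<close>

section \<open>Formal power series in finitely many variables\<close>

text \<open>
  The variables are indexed by the finite type \<open>'n\<close>, so that their number is \<open>CARD('n)\<close>, which is
  at least one. A power series is its coefficient function on exponent vectors \<open>'n \<Rightarrow> nat\<close>.
\<close>

definition power_series :: "('k::field, ('n::finite \<Rightarrow> nat) \<Rightarrow> 'k) module" where
  "power_series =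
    \<lparr>carrier = UNIV,
     mult = (\<lambda>f g e. \<Sum>(a, b) | (\<lambda>i. a i + b i) = e. f a * g b),
     one = (\<lambda>e. if e = (\<lambda>i. 0) then 1 else 0),
     zero = (\<lambda>e. 0),
     add = (\<lambda>f g e. f e + g e),
     smult = (\<lambda>c f e. c * f e)\<rparr>"


section \<open>Quotient algebras and isomorphisms of algebras\<close>

text \<open>
  The ring structure is that of \<open>A Quot I\<close>; as with \<^const>\<open>rcoset_mult\<close>, the scalar
  multiplication of a coset is the union over its representatives.
\<close>

definition quot_alg :: "('k, 'a) module \<Rightarrow> 'a set \<Rightarrow> ('k, 'a set) module" where
  "quot_alg A I =
    ring.extend (A Quot I) \<lparr>smult = (\<lambda>c X. \<Union>x\<in>X. I +>\<^bsub>A\<^esub> (c \<odot>\<^bsub>A\<^esub> x))\<rparr>"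

definition alg_iso ::
    "'k ring \<Rightarrow> ('k, 'a) module \<Rightarrow> ('k, 'b) module \<Rightarrow> ('a \<Rightarrow> 'b) set" where
  "alg_iso K A B =
    {h \<in> ring_iso A B. \<forall>c\<in>carrier K. \<forall>x\<in>carrier A. h (c \<odot>\<^bsub>A\<^esub> x) = c \<odot>\<^bsub>B\<^esub> h x}"


section \<open>Artinian rings and local rings\<close>

locale artinian_ring = ring +
  assumes descending_chain:
    "(\<And>k. ideal (C k) R) \<Longrightarrow> (\<And>k. C (Suc k) \<subseteq> C k) \<Longrightarrow> \<exists>N. \<forall>k\<ge>N. C k = C N"

locale local_ring = cring R for R (structure) and \<mm> +
  assumes unique_maximalideal: "maximalideal J R \<longleftrightarrow> J = \<mm>"


section \<open>The associated graded ring and the Hilbert function\<close>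

fun ideal_pow :: "('a, 'b) ring_scheme \<Rightarrow> 'a set \<Rightarrow> nat \<Rightarrow> 'a set" where
  "ideal_pow A \<mm> 0 = carrier A"
| "ideal_pow A \<mm> (Suc i) = ideal_prod A (ideal_pow A \<mm> i) \<mm>"

text \<open>
  The vector space $\mathfrak m^i/\mathfrak m^{i+1}$, as a subspace of the algebra
  $A/\mathfrak m^{i+1}$.
\<close>

definition graded_piece :: "('k, 'a) module \<Rightarrow> 'a set \<Rightarrow> nat \<Rightarrow> ('k, 'a set) module" where
  "graded_piece A \<mm> i =
    (quot_alg A (ideal_pow A \<mm> (Suc i)))
      \<lparr>carrier := (\<lambda>x. ideal_pow A \<mm> (Suc i) +>\<^bsub>A\<^esub> x) ` ideal_pow A \<mm> i\<rparr>"

definition hilbert_function :: "'k ring \<Rightarrow> ('k, 'a) module \<Rightarrow> 'a set \<Rightarrow> nat \<Rightarrow> nat" where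
  "hilbert_function K A \<mm> i = vectorspace.dim K (graded_piece A \<mm> i)"

text \<open>
  The product of the class of $x$ in $\mathfrak m^i/\mathfrak m^{i+1}$ and the class of $y$ in
  $\mathfrak m^j/\mathfrak m^{j+1}$ is the class of $xy$ in
  $\mathfrak m^{i+j}/\mathfrak m^{i+j+1}$.
\<close>

definition graded_mult ::
    "('k, 'a) module \<Rightarrow> 'a set \<Rightarrow> nat \<Rightarrow> nat \<Rightarrow> 'a set \<Rightarrow> 'a set \<Rightarrow> 'a set" where
  "graded_mult A \<mm> i j X Y =
    (\<Union>x\<in>X. \<Union>y\<in>Y. ideal_pow A \<mm> (Suc (i + j)) +>\<^bsub>A\<^esub> (x \<otimes>\<^bsub>A\<^esub> y))"

text \<open>
  The elements of $\bigoplus_i \mathfrak m^i/\mathfrak m^{i+1}$ are the finitely supported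
  sequences of homogeneous components.
\<close>

definition assoc_graded :: "('k, 'a) module \<Rightarrow> 'a set \<Rightarrow> ('k, nat \<Rightarrow> 'a set) module" where
  "assoc_graded A \<mm> =
    \<lparr>carrier = {u. (\<forall>i. u i \<in> carrier (graded_piece A \<mm> i)) \<and>
                   finite {i. u i \<noteq> \<zero>\<^bsub>graded_piece A \<mm> i\<^esub>}},
     mult = (\<lambda>u v k. \<Oplus>\<^bsub>graded_piece A \<mm> k\<^esub> i\<in>{..k}. graded_mult A \<mm> i (k - i) (u i) (v (k - i))),
     one = (\<lambda>i. if i = 0 then \<one>\<^bsub>graded_piece A \<mm> 0\<^esub> else \<zero>\<^bsub>graded_piece A \<mm> i\<^esub>),
     zero = (\<lambda>i. \<zero>\<^bsub>graded_piece A \<mm> i\<^esub>),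
     add = (\<lambda>u v i. u i \<oplus>\<^bsub>graded_piece A \<mm> i\<^esub> v i),
     smult = (\<lambda>c u i. c \<odot>\<^bsub>graded_piece A \<mm> i\<^esub> u i)\<rparr>"

definition canonically_graded :: "'k ring \<Rightarrow> ('k, 'a) module \<Rightarrow> 'a set \<Rightarrow> bool" where
  "canonically_graded K A \<mm> \<longleftrightarrow> alg_iso K A (assoc_graded A \<mm>) \<noteq> {}"


section \<open>Gorenstein rings\<close>

text \<open>The socle $(0 : \mathfrak m)$, as a vector space.\<close>

definition socle :: "('k, 'a) module \<Rightarrow> 'a set \<Rightarrow> ('k, 'a) module" where
  "socle A \<mm> = A\<lparr>carrier := {x \<in> carrier A. \<forall>y\<in>\<mm>. x \<otimes>\<^bsub>A\<^esub> y = \<zero>\<^bsub>A\<^esub>}\<rparr>"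

definition artinian_gorenstein :: "'k ring \<Rightarrow> ('k, 'a) module \<Rightarrow> 'a set \<Rightarrow> bool" where
  "artinian_gorenstein K A \<mm> \<longleftrightarrow>
    artinian_ring A \<and> local_ring A \<mm> \<and> vectorspace.dim K (socle A \<mm>) = 1"

end

theory Submission
  imports "HOL-Analysis.Cartesian_Space" Defs
begin

text \<open>
  Multiplication induces a perfect pairing of $\mathfrak m/\mathfrak m^2$ and
  $\mathfrak m^2/\mathfrak m^3$ with values in the socle $\mathfrak m^3 \cong K$. Extend the latter
  isomorphism to a linear form $\varphi$ on $\mathfrak m^2$. Replacing the generators $x_i$ by
  $x_i' = x_i + d_i$ with $d_i \in \mathfrak m^2$ changes $\varphi(x_ix_j)$ by
  $\varphi(x_id_j) + \varphi(x_jd_i)$ because $\mathfrak m^4 = 0$; as the pairing is perfect, there are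
  $d_i$ with $\varphi(x_jd_i) = -\varphi(x_ix_j)/2$, and then all $x_i'x_j'$ lie in $\ker\varphi$.
  Hence $A = K \oplus \langle x_i'\rangle \oplus \ker\varphi \oplus \mathfrak m^3$ is a grading of $A$
  that splits the $\mathfrak m$-adic filtration.
\<close>

section \<open>Formal power series\<close>

text \<open>The vanishing of the Hilbert function in degree 4 only gives \<open>P 5 = P 4\<close>;
  it takes the descending chain condition together with the invertibility of 1 - y, for y in the
  maximal ideal, to conclude that the fourth power is zero. The third power is then a
  one-dimensional space inside the socle, hence equal to it, and the nondegeneracy of the pairing
  rests on this equality. Perfectness is obtained from the side of degree 2: a square linear system
  with trivial kernel is solvable for every right-hand side. The same solvability, applied to dual
  vectors, shows that the corrected lifts are independent modulo the square of the maximal ideal.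
  The form \<phi> depends on an arbitrary complement of the third power in the second; the
  correction adapts the linear part to that choice. Products of total degree 3 or more impose no
  condition, because there the pieces are the powers themselves. The passage from such a splitting
  to the isomorphism with the associated graded ring is a separate criterion, stated for an
  arbitrary multiplicative sequence of complements.\<close>

lemma finite_add_pairs: "finite {p. (\<lambda>i. fst p i + snd p i) = (e :: 'n::finite \<Rightarrow> nat)}"
proof -
  have "finite (Pi\<^sub>E UNIV (\<lambda>i. {..e i}))" by (intro finite_PiE) auto
  moreover have "{p. (\<lambda>i. fst p i + snd p i) = e} \<subseteq> Pi\<^sub>E UNIV (\<lambda>i. {..e i}) \<times> Pi\<^sub>E UNIV (\<lambda>i. {..e i})"
    by auto
  ultimately show ?thesis by (meson finite_SigmaI finite_subset)
qed

lemma power_series_simps [simp]: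
  "carrier power_series = UNIV"
  "\<one>\<^bsub>power_series\<^esub> = (\<lambda>e. if e = (\<lambda>i. 0) then 1 else 0)"
  "\<zero>\<^bsub>power_series\<^esub> = (\<lambda>e. 0)"
  "f \<oplus>\<^bsub>power_series\<^esub> g = (\<lambda>e. f e + g e)"
  "c \<odot>\<^bsub>power_series\<^esub> f = (\<lambda>e. c * f e)"
  by (simp_all add: power_series_def)

lemma power_series_mult:
  "(f \<otimes>\<^bsub>power_series\<^esub> g) e = (\<Sum>p | (\<lambda>i. fst p i + snd p i) = e. f (fst p) * g (snd p))"
  by (simp add: power_series_def case_prod_unfold)

lemma power_series_mult_comm: "f \<otimes>\<^bsub>power_series\<^esub> g = g \<otimes>\<^bsub>power_series\<^esub> f"
proof
  fix e
  show "(f \<otimes>\<^bsub>power_series\<^esub> g) e = (g \<otimes>\<^bsub>power_series\<^esub> f) e"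
    unfolding power_series_mult
    by (rule sum.reindex_bij_witness[where i=prod.swap and j=prod.swap]) (auto simp: add.commute mult.commute)
qed

lemma power_series_mult_assoc:
  "(f \<otimes>\<^bsub>power_series\<^esub> g) \<otimes>\<^bsub>power_series\<^esub> h = f \<otimes>\<^bsub>power_series\<^esub> (g \<otimes>\<^bsub>power_series\<^esub> h)"
proof
  fix e
  show "((f \<otimes>\<^bsub>power_series\<^esub> g) \<otimes>\<^bsub>power_series\<^esub> h) e = (f \<otimes>\<^bsub>power_series\<^esub> (g \<otimes>\<^bsub>power_series\<^esub> h)) e"
    unfolding power_series_mult sum_distrib_left sum_distrib_right
    apply (subst sum.Sigma)
    using finite_add_pairs apply blast
    using finite_add_pairs apply blast
    apply (subst sum.Sigma)
    using finite_add_pairs apply blast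
    using finite_add_pairs apply blast
    \<comment> \<open>Both sides run over the triples with a + b + c = e: the left side groups them
      as ((a + b, c), (a, b)), the right side as ((a, b + c), (b, c)).\<close>
    apply (rule sum.reindex_bij_witness[where
       i="\<lambda>((a, q), (b, c)). ((\<lambda>i. a i + b i, c), (a, b))" and
       j="\<lambda>((p, c), (a, b)). ((a, \<lambda>i. b i + c i), (b, c))"])
    by (auto simp: mult.assoc fun_eq_iff) (metis add.assoc)+
qed

lemma power_series_one_mult:
  fixes f :: "('n::finite \<Rightarrow> nat) \<Rightarrow> 'k::field"
  shows "\<one>\<^bsub>power_series\<^esub> \<otimes>\<^bsub>power_series\<^esub> f = f"
proof
  fix e
  have "(\<one>\<^bsub>power_series\<^esub> \<otimes>\<^bsub>power_series\<^esub> f) e = (\<Sum>p\<in>{(\<lambda>i::'n. 0::nat, e)}. f (snd p))"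
    unfolding power_series_mult power_series_simps
    by (rule sum.mono_neutral_cong_right) (auto simp: finite_add_pairs)
  then show "(\<one>\<^bsub>power_series\<^esub> \<otimes>\<^bsub>power_series\<^esub> f) e = f e" by simp
qed

lemma power_series_algebra: "algebra class_ring power_series"
proof (rule algebraI)
  show "cring power_series"
  proof (rule cringI)
    show "abelian_group power_series"
    proof (rule abelian_groupI)
      fix f :: "('n::finite \<Rightarrow> nat) \<Rightarrow> 'k::field"
      show "\<exists>g\<in>carrier power_series. g \<oplus>\<^bsub>power_series\<^esub> f = \<zero>\<^bsub>power_series\<^esub>"
        by (rule bexI[of _ "\<lambda>e. - f e"]) auto
    qed (auto simp: add.assoc add.commute)
    show "Group.comm_monoid power_series"
      by (rule comm_monoidI)
         (use power_series_mult_assoc power_series_one_mult power_series_mult_comm in auto)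
  qed (auto simp: power_series_mult fun_eq_iff algebra_simps sum.distrib)
qed (auto simp: class_cring.cring_axioms power_series_mult fun_eq_iff algebra_simps sum_distrib_left)

text \<open>This is the equation f g = 1 solved for the coefficient of g at \<open>e\<close>. The
  pair (0, e) carries the unknown; all other pairs have a second component of smaller total degree,
  which is the termination measure. For a series without constant term the division by zero returns
  0.\<close>

function series_inv :: "(('n::finite \<Rightarrow> nat) \<Rightarrow> 'k::field) \<Rightarrow> ('n \<Rightarrow> nat) \<Rightarrow> 'k" where
  "series_inv f e = ((if e = (\<lambda>i. 0) then 1 else 0) -
     (\<Sum>p \<in> {p. (\<lambda>i. fst p i + snd p i) = e \<and> fst p \<noteq> (\<lambda>i. 0)}. f (fst p) * series_inv f (snd p))) / f (\<lambda>i. 0)"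
  by auto
termination
proof (relation "measure (\<lambda>(f, e). \<Sum>i\<in>UNIV. e i)")
  fix f :: "('n::finite \<Rightarrow> nat) \<Rightarrow> 'k::field" and e and p :: "('n \<Rightarrow> nat) \<times> ('n \<Rightarrow> nat)"
  assume "p \<in> {p. (\<lambda>i. fst p i + snd p i) = e \<and> fst p \<noteq> (\<lambda>i. 0)}"
  then have e: "e = (\<lambda>i. fst p i + snd p i)" and "fst p \<noteq> (\<lambda>i. 0)" by auto
  then obtain i where i: "fst p i > 0" by auto
  have "sum (snd p) UNIV < sum e UNIV"
    unfolding e by (rule sum_strict_mono_ex1) (use i in auto)
  then show "((f, snd p), f, e) \<in> measure (\<lambda>(f, e). \<Sum>i\<in>UNIV. e i)" by simp
qed simp

declare series_inv.simps [simp del]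

lemma power_series_inverse:
  assumes "f (\<lambda>i. 0) \<noteq> 0"
  shows "f \<otimes>\<^bsub>power_series\<^esub> series_inv f = \<one>\<^bsub>power_series\<^esub>"
proof
  fix e
  let ?T = "\<lambda>p. f (fst p) * series_inv f (snd p)"
  have "(f \<otimes>\<^bsub>power_series\<^esub> series_inv f) e = f (\<lambda>i. 0) * series_inv f e +
     (\<Sum>p \<in> {p. (\<lambda>i. fst p i + snd p i) = e \<and> fst p \<noteq> (\<lambda>i. 0)}. ?T p)"
  proof -
    have "{p. (\<lambda>i. fst p i + snd p i) = e} =
      insert (\<lambda>i. 0, e) {p. (\<lambda>i. fst p i + snd p i) = e \<and> fst p \<noteq> (\<lambda>i. 0)}" by auto
    then show ?thesis unfolding power_series_mult
      by (simp, subst sum.insert) (auto intro: finite_subset[OF _ finite_add_pairs[of e]])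
  qed
  also have "\<dots> = (if e = (\<lambda>i. 0) then 1 else 0)"
    by (subst series_inv.simps) (use assms in simp)
  finally show "(f \<otimes>\<^bsub>power_series\<^esub> series_inv f) e = \<one>\<^bsub>power_series\<^esub> e" by simp
qed

section \<open>Variables and series without constant term\<close>

definition series_var :: "'n \<Rightarrow> ('n \<Rightarrow> nat) \<Rightarrow> 'k::field" where
  "series_var i e = (if e = (\<lambda>j. if j = i then 1 else 0) then 1 else 0)"

text \<open>Only the pair whose first exponent is the unit vector of \<open>i\<close> contributes,
  and such a pair exists exactly when \<open>e i\<close> is positive.\<close>

lemma series_var_mult:
  fixes f :: "('n::finite \<Rightarrow> nat) \<Rightarrow> 'k::field"
  shows "(series_var i \<otimes>\<^bsub>power_series\<^esub> f) e = (if e i = 0 then 0 else f (e(i := e i - 1)))"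
proof -
  let ?d = "\<lambda>j. if j = i then 1 else (0::nat)"
  have "(series_var i \<otimes>\<^bsub>power_series\<^esub> f) e =
      (\<Sum>p \<in> {p. (\<lambda>i. fst p i + snd p i) = e \<and> fst p = ?d}. f (snd p))"
    unfolding power_series_mult
    by (rule sum.mono_neutral_cong_right) (auto simp: finite_add_pairs series_var_def)
  also have "{p. (\<lambda>i. fst p i + snd p i) = e \<and> fst p = ?d} =
      (if e i = 0 then {} else {(?d, e(i := e i - 1))})"
  proof -
    have "fst p = ?d \<and> (\<lambda>j. fst p j + snd p j) = e \<longleftrightarrow> e i \<noteq> 0 \<and> p = (?d, e(i := e i - 1))" for p
    proof
      assume p: "fst p = ?d \<and> (\<lambda>j. fst p j + snd p j) = e"
      then have "e j = ?d j + snd p j" for j by auto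
      then show "e i \<noteq> 0 \<and> p = (?d, e(i := e i - 1))"
        using p by (auto intro!: prod_eqI)
    qed auto
    then show ?thesis by auto
  qed
  finally show ?thesis by (simp add: fun_upd_def)
qed

lemma power_series_finsum:
  "finite S \<Longrightarrow> (\<Oplus>\<^bsub>power_series\<^esub>i\<in>S. F i) = (\<lambda>e. \<Sum>i\<in>S. F i e)"
proof (induction rule: finite_induct)
  case empty
  interpret algebra class_ring "power_series :: ('k::field, ('n::finite \<Rightarrow> nat) \<Rightarrow> 'k) module" by (rule power_series_algebra)
  show ?case by (simp add: M.finsum_empty)
next
  case (insert x T)
  interpret algebra class_ring "power_series :: ('k::field, ('n::finite \<Rightarrow> nat) \<Rightarrow> 'k) module" by (rule power_series_algebra)
  show ?case using insert by (subst M.finsum_insert) auto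
qed

text \<open>In the quotient this shows that the classes of the variables generate the maximal ideal.
  Each nonconstant monomial is charged to a single variable dividing it, so that none is counted
  twice.\<close>

lemma power_series_no_constant_term:
  fixes f :: "('n::finite \<Rightarrow> nat) \<Rightarrow> 'k::field"
  assumes "f (\<lambda>i. 0) = 0"
  obtains g where "f = (\<Oplus>\<^bsub>power_series\<^esub>i\<in>UNIV. series_var i \<otimes>\<^bsub>power_series\<^esub> g i)"
proof
  \<comment> \<open>\<open>s e\<close> picks a variable that occurs in the monomial with exponent
    \<open>e\<close>; \<open>g i\<close> collects the monomials charged to \<open>i\<close>, each
    divided by that variable.\<close>
  define s :: "('n \<Rightarrow> nat) \<Rightarrow> 'n" where "s e = (SOME i. e i \<noteq> 0)" for e
  define g where "g i e = (if s (e(i := Suc (e i))) = i then f (e(i := Suc (e i))) else 0)" for i e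
  show "f = (\<Oplus>\<^bsub>power_series\<^esub>i\<in>UNIV. series_var i \<otimes>\<^bsub>power_series\<^esub> g i)"
  proof
    fix e
    have "(\<Oplus>\<^bsub>power_series\<^esub>i\<in>UNIV. series_var i \<otimes>\<^bsub>power_series\<^esub> g i) e =
        (\<Sum>i\<in>UNIV. if e i \<noteq> 0 \<and> s e = i then f e else 0)"
      unfolding power_series_finsum[OF finite] series_var_mult
      by (rule sum.cong) (auto simp: g_def)
    also have "\<dots> = f e"
    proof (cases "e = (\<lambda>i. 0)")
      case False
      then have "\<exists>i. e i \<noteq> 0" by auto
      then have "e (s e) \<noteq> 0" unfolding s_def by (rule someI_ex)
      then have "(\<Sum>i\<in>UNIV. if e i \<noteq> 0 \<and> s e = i then f e else 0) = (\<Sum>i\<in>UNIV. if s e = i then f e else 0)"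
        by (intro sum.cong) auto
      then show ?thesis by simp
    qed (use assms in simp)
    finally show "f e = (\<Oplus>\<^bsub>power_series\<^esub>i\<in>UNIV. series_var i \<otimes>\<^bsub>power_series\<^esub> g i) e" by simp
  qed
qed

section \<open>Algebras over a field and their quotients\<close>

text \<open>With the scalars fixed to \<open>class_ring\<close>, the module laws can be stated with
  the operations of the field type and without carrier premises on scalars.\<close>

locale field_algebra = algebra "class_ring :: 'k::field ring" A for A :: "('k::field, 'a) module" (structure)
begin

lemma K_smult_closed [simp, intro]: "x \<in> carrier A \<Longrightarrow> c \<odot> x \<in> carrier A"
  using smult_closed[of c x] by simp

lemma K_smult_l_distr: "x \<in> carrier A \<Longrightarrow> (c + d) \<odot> x = c \<odot> x \<oplus> d \<odot> x"
  using smult_l_distr[of c d x] by simp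

lemma K_smult_r_distr: "x \<in> carrier A \<Longrightarrow> y \<in> carrier A \<Longrightarrow> c \<odot> (x \<oplus> y) = c \<odot> x \<oplus> c \<odot> y"
  using smult_r_distr[of c x y] by simp

lemma K_smult_assoc: "x \<in> carrier A \<Longrightarrow> (c * d) \<odot> x = c \<odot> (d \<odot> x)"
  using smult_assoc1[of c d x] by simp

lemma K_smult_one [simp]: "x \<in> carrier A \<Longrightarrow> 1 \<odot> x = x"
  using smult_one[of x] by simp

lemma K_smult_l_null [simp]: "x \<in> carrier A \<Longrightarrow> 0 \<odot> x = \<zero>"
  using smult_l_null[of x] by simp

lemma K_smult_r_null [simp]: "c \<odot> \<zero> = \<zero>"
  using smult_r_null[of c] by simp

lemma K_smult_mult: "x \<in> carrier A \<Longrightarrow> y \<in> carrier A \<Longrightarrow> (c \<odot> x) \<otimes> y = c \<odot> (x \<otimes> y)"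
  using smult_assoc2[of c x y] by simp

lemma K_mult_smult: "x \<in> carrier A \<Longrightarrow> y \<in> carrier A \<Longrightarrow> x \<otimes> (c \<odot> y) = c \<odot> (x \<otimes> y)"
  using K_smult_mult[of y x c] by (simp add: m_comm)

lemma K_smult_minus: "x \<in> carrier A \<Longrightarrow> c \<odot> (\<ominus> x) = \<ominus> (c \<odot> x)"
  using smult_r_minus[of c x] by simp

lemma K_smult_l_minus: "x \<in> carrier A \<Longrightarrow> (- c) \<odot> x = \<ominus> (c \<odot> x)"
  using smult_l_minus[of c x] by (simp add: class_ring_simps)

lemma K_smult_diff:
  "x \<in> carrier A \<Longrightarrow> y \<in> carrier A \<Longrightarrow> c \<odot> (x \<ominus> y) = c \<odot> x \<ominus> c \<odot> y"
  by (simp add: a_minus_def K_smult_r_distr K_smult_minus)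

text \<open>A scalar acts as multiplication by the ring element \<open>c \<odot> \<one>\<close>, so
  ideals of the ring are subspaces.\<close>

lemma ideal_smult: "ideal J A \<Longrightarrow> x \<in> J \<Longrightarrow> c \<odot> x \<in> J"
  using ideal.I_l_closed[of J A x "c \<odot> \<one>"] ideal.Icarr[of J A x] by (simp add: K_smult_mult)

lemma ideal_add: "ideal J A \<Longrightarrow> x \<in> J \<Longrightarrow> y \<in> J \<Longrightarrow> x \<oplus> y \<in> J"
  by (simp add: additive_subgroup.a_closed ideal.axioms(1))

lemma ideal_neg: "ideal J A \<Longrightarrow> x \<in> J \<Longrightarrow> \<ominus> x \<in> J"
  by (simp add: additive_subgroup.a_inv_closed ideal.axioms(1))

lemma ideal_diff: "ideal J A \<Longrightarrow> x \<in> J \<Longrightarrow> y \<in> J \<Longrightarrow> x \<ominus> y \<in> J"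
  by (simp add: a_minus_def ideal_add ideal_neg)

lemma ideal_zero: "ideal J A \<Longrightarrow> \<zero> \<in> J"
  by (simp add: additive_subgroup.zero_closed ideal.axioms(1))

lemma coset_eq_iff:
  "ideal J A \<Longrightarrow> x \<in> carrier A \<Longrightarrow> y \<in> carrier A \<Longrightarrow> J +> x = J +> y \<longleftrightarrow> x \<ominus> y \<in> J"
  using quotient_eq_iff_same_a_r_cos by metis

lemma coset_self: "ideal J A \<Longrightarrow> x \<in> carrier A \<Longrightarrow> x \<in> J +> x"
  by (rule abelian_subgroup.a_rcos_self[OF abelian_subgroupI3[OF ideal.axioms(1) is_abelian_group]])

lemma coset_memE:
  assumes "y \<in> J +> x"
  obtains h where "h \<in> J" "y = h \<oplus> x"
  using assms unfolding a_r_coset_def' UN_iff singleton_iff by blast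

lemma coset_eq_zero_iff: "ideal J A \<Longrightarrow> x \<in> carrier A \<Longrightarrow> J +> x = J \<longleftrightarrow> x \<in> J"
proof -
  assume "ideal J A" and x: "x \<in> carrier A"
  then interpret J: ideal J A by simp
  show ?thesis using J.a_rcos_const J.a_rcos_self[OF x] by blast
qed

lemma algebra_vectorspace: "vectorspace class_ring A"
  by (simp add: vectorspace_def class_field module_axioms)

lemma vectorspace_submodule:
  assumes "H \<subseteq> carrier A" "\<zero> \<in> H" "\<And>x y. x \<in> H \<Longrightarrow> y \<in> H \<Longrightarrow> x \<oplus> y \<in> H"
    "\<And>c x. x \<in> H \<Longrightarrow> c \<odot> x \<in> H"
  shows "submodule class_ring H A"
  using assms by (auto intro!: submodule.intro module_axioms)

lemma vectorspace_restrict: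
  assumes "submodule class_ring H A"
  shows "vectorspace class_ring (A\<lparr>carrier := H\<rparr>)"
  using assms by (simp add: vectorspace_def class_field submodule_is_module)

lemma ideal_submodule: "ideal J A \<Longrightarrow> submodule class_ring J A"
  by (rule vectorspace_submodule) (auto simp: ideal.Icarr ideal_zero ideal_add ideal_smult)

end

section \<open>Quotient algebras modulo an ideal\<close>

lemma quot_alg_fields [simp]:
  "carrier (quot_alg A J) = a_rcosets\<^bsub>A\<^esub> J"
  "mult (quot_alg A J) = rcoset_mult A J"
  "one (quot_alg A J) = J +>\<^bsub>A\<^esub> \<one>\<^bsub>A\<^esub>"
  "zero (quot_alg A J) = J"
  "add (quot_alg A J) = set_add A"
  "smult (quot_alg A J) = (\<lambda>c X. \<Union>x\<in>X. J +>\<^bsub>A\<^esub> (c \<odot>\<^bsub>A\<^esub> x))"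
  by (simp_all add: quot_alg_def ring.extend_def FactRing_def)

text \<open>\<open>quot_alg\<close> extends the record of the quotient ring by a scalar
  multiplication. The ring axioms only concern the old fields, but they have to be carried over to
  the record with the new extension slot.\<close>

lemma cring_extend: "cring R \<Longrightarrow> cring (ring.extend R X)"
proof -
  assume "cring R"
  interpret cring R by fact
  have [simp]: "carrier (ring.extend R X) = carrier R" "mult (ring.extend R X) = mult R"
    "one (ring.extend R X) = one R" "zero (ring.extend R X) = zero R" "add (ring.extend R X) = add R"
    by (simp_all add: ring.extend_def)
  show "cring (ring.extend R X)"
  proof (rule cringI)
    show "abelian_group (ring.extend R X)"
    proof (rule abelian_groupI)
      fix x assume "x \<in> carrier (ring.extend R X)"
      then show "\<exists>y\<in>carrier (ring.extend R X). y \<oplus>\<^bsub>ring.extend R X\<^esub> x = \<zero>\<^bsub>ring.extend R X\<^esub>"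
        by (intro bexI[of _ "\<ominus>\<^bsub>R\<^esub> x"]) (simp_all add: l_neg)
    qed (simp_all add: a_ac)
    show "Group.comm_monoid (ring.extend R X)"
      by (rule comm_monoidI) (auto simp: m_ac)
  qed (simp add: l_distr)
qed

context field_algebra
begin

lemma quot_alg_carrier: "carrier (quot_alg A J) = (\<lambda>x. J +> x) ` carrier A"
  by (auto simp: A_RCOSETS_def' )

lemma quot_alg_mult:
  "ideal J A \<Longrightarrow> x \<in> carrier A \<Longrightarrow> y \<in> carrier A \<Longrightarrow>
    (J +> x) \<otimes>\<^bsub>quot_alg A J\<^esub> (J +> y) = J +> x \<otimes> y"
  unfolding quot_alg_fields by (rule ideal.rcoset_mult_add)

lemma quot_alg_add:
  "ideal J A \<Longrightarrow> x \<in> carrier A \<Longrightarrow> y \<in> carrier A \<Longrightarrow>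
    (J +> x) <+>\<^bsub>A\<^esub> (J +> y) = J +> (x \<oplus> y)"
proof -
  assume "ideal J A" and x: "x \<in> carrier A" "y \<in> carrier A"
  then interpret J: ideal J A by simp
  show ?thesis using x by (rule J.a_rcos_sum)
qed

text \<open>Two representatives differ by some h in \<open>J\<close>, and their multiples by
  \<open>c \<odot> h\<close>, again in \<open>J\<close>. All members of the union therefore
  coincide, and the union is over a nonempty coset.\<close>

lemma quot_alg_smult:
  assumes "ideal J A" "x \<in> carrier A"
  shows "c \<odot>\<^bsub>quot_alg A J\<^esub> (J +> x) = J +> c \<odot> x"
proof -
  interpret J: ideal J A by fact
  have "J +> c \<odot> y = J +> c \<odot> x" if y: "y \<in> J +> x" for y
  proof -
    obtain h where h: "h \<in> J" "y = h \<oplus> x" using y by (rule coset_memE)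
    have hc: "h \<in> carrier A" using h(1) by (rule J.Icarr)
    have "c \<odot> y \<ominus> c \<odot> x = c \<odot> h"
      unfolding h(2) a_minus_def K_smult_r_distr[OF hc assms(2)] using hc assms(2)
      by (simp add: M.a_assoc M.r_neg)
    then have "c \<odot> y \<ominus> c \<odot> x \<in> J" using ideal_smult[OF assms(1) h(1)] by simp
    then show ?thesis
      using coset_eq_iff[OF assms(1) K_smult_closed[OF M.a_closed[OF hc assms(2)]] K_smult_closed[OF assms(2)]]
      unfolding h(2) by blast
  qed
  then have "(\<Union>y\<in>J +> x. J +> c \<odot> y) = (\<Union>y\<in>J +> x. J +> c \<odot> x)" by (intro SUP_cong refl)
  moreover have "J +> x \<noteq> {}" using J.a_rcos_self[OF assms(2)] by auto
  ultimately show ?thesis unfolding quot_alg_fields by simp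
qed

lemma quot_alg_field_algebra:
  assumes "ideal J A"
  shows "field_algebra (quot_alg A J)"
proof -
  have cr: "cring (quot_alg A J)"
    unfolding quot_alg_def
    by (intro cring_extend ideal.quotient_is_cring assms M_cring)
  have Q: "\<exists>x\<in>carrier A. X = J +> x" if "X \<in> carrier (quot_alg A J)" for X
    using that unfolding quot_alg_carrier by blast
  show ?thesis unfolding field_algebra_def
  proof (rule algebraI)
    show "cring (quot_alg A J)" by (rule cr)
    show "cring (class_ring :: 'k ring)" by (rule class_cring.cring_axioms)
  next
    fix c :: 'k and X assume "X \<in> carrier (quot_alg A J)"
    then obtain x where x: "x \<in> carrier A" "X = J +> x" using Q by blast
    show "c \<odot>\<^bsub>quot_alg A J\<^esub> X \<in> carrier (quot_alg A J)"
      unfolding x(2) quot_alg_smult[OF assms x(1)] quot_alg_carrier using x(1) by blast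
    show "\<one>\<^bsub>class_ring\<^esub> \<odot>\<^bsub>quot_alg A J\<^esub> X = X"
      unfolding x(2) quot_alg_smult[OF assms x(1)] smult_one[OF x(1)] ..
    fix d :: 'k
    have "(c + d) \<odot>\<^bsub>quot_alg A J\<^esub> X =
        c \<odot>\<^bsub>quot_alg A J\<^esub> X \<oplus>\<^bsub>quot_alg A J\<^esub> d \<odot>\<^bsub>quot_alg A J\<^esub> X"
      unfolding x(2) quot_alg_smult[OF assms x(1)] quot_alg_fields(5)
        quot_alg_add[OF assms K_smult_closed[OF x(1)] K_smult_closed[OF x(1)]] K_smult_l_distr[OF x(1)] ..
    then show "(c \<oplus>\<^bsub>class_ring\<^esub> d) \<odot>\<^bsub>quot_alg A J\<^esub> X =
        c \<odot>\<^bsub>quot_alg A J\<^esub> X \<oplus>\<^bsub>quot_alg A J\<^esub> d \<odot>\<^bsub>quot_alg A J\<^esub> X"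
      by (simp only: monoid.simps ring.simps)
    have "(c * d) \<odot>\<^bsub>quot_alg A J\<^esub> X = c \<odot>\<^bsub>quot_alg A J\<^esub> (d \<odot>\<^bsub>quot_alg A J\<^esub> X)"
      unfolding x(2) quot_alg_smult[OF assms x(1)] quot_alg_smult[OF assms K_smult_closed[OF x(1)]]
        K_smult_assoc[OF x(1)] ..
    then show "(c \<otimes>\<^bsub>class_ring\<^esub> d) \<odot>\<^bsub>quot_alg A J\<^esub> X = c \<odot>\<^bsub>quot_alg A J\<^esub> (d \<odot>\<^bsub>quot_alg A J\<^esub> X)"
      by (simp only: monoid.simps ring.simps)
    fix Y assume "Y \<in> carrier (quot_alg A J)"
    then obtain y where y: "y \<in> carrier A" "Y = J +> y" using Q by blast
    show "c \<odot>\<^bsub>quot_alg A J\<^esub> (X \<oplus>\<^bsub>quot_alg A J\<^esub> Y) =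
        c \<odot>\<^bsub>quot_alg A J\<^esub> X \<oplus>\<^bsub>quot_alg A J\<^esub> c \<odot>\<^bsub>quot_alg A J\<^esub> Y"
      unfolding x(2) y(2) quot_alg_fields(5) quot_alg_add[OF assms x(1) y(1)] quot_alg_smult[OF assms x(1)]
        quot_alg_smult[OF assms y(1)] quot_alg_smult[OF assms M.a_closed[OF x(1) y(1)]]
        quot_alg_add[OF assms K_smult_closed[OF x(1)] K_smult_closed[OF y(1)]] K_smult_r_distr[OF x(1) y(1)] ..
    show "c \<odot>\<^bsub>quot_alg A J\<^esub> X \<otimes>\<^bsub>quot_alg A J\<^esub> Y = c \<odot>\<^bsub>quot_alg A J\<^esub> (X \<otimes>\<^bsub>quot_alg A J\<^esub> Y)"
      unfolding x(2) y(2) quot_alg_mult[OF assms x(1) y(1)] quot_alg_smult[OF assms x(1)]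
        quot_alg_smult[OF assms m_closed[OF x(1) y(1)]]
        quot_alg_mult[OF assms K_smult_closed[OF x(1)] y(1)] K_smult_mult[OF x(1) y(1)] ..

  qed
qed

end

section \<open>The adic filtration\<close>

declare ideal_pow.simps(2) [simp del]

locale adic_algebra = field_algebra A for A :: "('k::field, 'a) module" (structure) +
  fixes \<mm>
  assumes ideal_m: "ideal \<mm> A"
begin

abbreviation P :: "nat \<Rightarrow> 'a set" where "P \<equiv> ideal_pow A \<mm>"
abbreviation G :: "nat \<Rightarrow> ('k, 'a set) module" where "G \<equiv> graded_piece A \<mm>"

lemma ideal_P: "ideal (P i) A"
  by (induction i) (simp_all add: oneideal ideal_prod_is_ideal ideal_m ideal_pow.simps(2))

lemma P_carrier: "x \<in> P i \<Longrightarrow> x \<in> carrier A"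
  by (rule ideal.Icarr[OF ideal_P])

lemmas P_closed = ideal_zero[OF ideal_P] ideal_add[OF ideal_P] ideal_neg[OF ideal_P]
  ideal_diff[OF ideal_P] ideal_smult[OF ideal_P]

lemma P_one: "P (Suc 0) = \<mm>"
  using ideal_prod_commute[OF oneideal ideal_m] ideal_prod_one[OF ideal_m] by (simp add: ideal_pow.simps(2))

lemma P_Suc_subset: "P (Suc i) \<subseteq> P i"
  using ideal_prod_inter[OF ideal_P ideal_m] by (auto simp: ideal_pow.simps(2))

lemma P_antimono: "i \<le> j \<Longrightarrow> P j \<subseteq> P i"
  by (rule lift_Suc_antimono_le) (use P_Suc_subset in auto)

lemma P_add: "P (i + j) = ideal_prod A (P i) (P j)"
proof (induction j)
  case 0
  then show ?case by (simp add: ideal_prod_one ideal_P)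
next
  case (Suc j)
  then show ?case by (simp add: ideal_prod_assoc ideal_P ideal_m ideal_pow.simps(2))
qed

lemma P_mult: "x \<in> P i \<Longrightarrow> y \<in> P j \<Longrightarrow> x \<otimes> y \<in> P (i + j)"
  unfolding P_add by (rule ideal_prod.prod)

lemma P_stable: "P (Suc i) = P i \<Longrightarrow> P (i + k) = P i"
  by (induction k) (auto simp: ideal_pow.simps(2))

lemma graded_piece_fields:
  "carrier (G i) = (\<lambda>x. P (Suc i) +> x) ` P i"
  "zero (G i) = P (Suc i)"
  "add (G i) = add (quot_alg A (P (Suc i)))"
  "smult (G i) = smult (quot_alg A (P (Suc i)))"
  "one (G i) = P (Suc i) +> \<one>"
  by (simp_all add: graded_piece_def)

lemma graded_piece_add:
  "x \<in> carrier A \<Longrightarrow> y \<in> carrier A \<Longrightarrow>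
    (P (Suc i) +> x) \<oplus>\<^bsub>G i\<^esub> (P (Suc i) +> y) = P (Suc i) +> (x \<oplus> y)"
  by (simp only: graded_piece_fields quot_alg_fields quot_alg_add[OF ideal_P])

lemma graded_piece_smult:
  "x \<in> carrier A \<Longrightarrow> c \<odot>\<^bsub>G i\<^esub> (P (Suc i) +> x) = P (Suc i) +> (c \<odot> x)"
  by (simp only: graded_piece_fields quot_alg_smult[OF ideal_P])

lemma graded_piece_vectorspace: "vectorspace class_ring (G i)"
proof -
  interpret Q: field_algebra "quot_alg A (P (Suc i))"
    by (rule quot_alg_field_algebra[OF ideal_P])
  have "submodule class_ring ((\<lambda>x. P (Suc i) +> x) ` P i) (quot_alg A (P (Suc i)))"
  proof (rule Q.vectorspace_submodule)
    show "(\<lambda>x. P (Suc i) +> x) ` P i \<subseteq> carrier (quot_alg A (P (Suc i)))"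
      unfolding quot_alg_carrier using P_carrier by auto
    show "\<zero>\<^bsub>quot_alg A (P (Suc i))\<^esub> \<in> (\<lambda>x. P (Suc i) +> x) ` P i"
      using coset_eq_zero_iff[OF ideal_P[of "Suc i"], of \<zero>] P_closed(1)
      by (auto intro!: image_eqI[of _ _ \<zero>])
  next
    fix X Y assume "X \<in> (\<lambda>x. P (Suc i) +> x) ` P i" "Y \<in> (\<lambda>x. P (Suc i) +> x) ` P i"
    then obtain x y where "x \<in> P i" "y \<in> P i" "X = P (Suc i) +> x" "Y = P (Suc i) +> y" by auto
    then have "X \<oplus>\<^bsub>quot_alg A (P (Suc i))\<^esub> Y = P (Suc i) +> (x \<oplus> y)" "x \<oplus> y \<in> P i"
      using quot_alg_add[OF ideal_P[of "Suc i"]] P_carrier P_closed by auto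
    then show "X \<oplus>\<^bsub>quot_alg A (P (Suc i))\<^esub> Y \<in> (\<lambda>x. P (Suc i) +> x) ` P i" by blast
  next
    fix c :: 'k and X assume "X \<in> (\<lambda>x. P (Suc i) +> x) ` P i"
    then obtain x where "x \<in> P i" "X = P (Suc i) +> x" by auto
    then have "c \<odot>\<^bsub>quot_alg A (P (Suc i))\<^esub> X = P (Suc i) +> (c \<odot> x)" "c \<odot> x \<in> P i"
      using quot_alg_smult[OF ideal_P[of "Suc i"]] P_carrier P_closed(5) by blast+
    then show "c \<odot>\<^bsub>quot_alg A (P (Suc i))\<^esub> X \<in> (\<lambda>x. P (Suc i) +> x) ` P i" by blast
  qed
  then show ?thesis unfolding graded_piece_def by (rule Q.vectorspace_restrict)
qed

lemma graded_piece_finsum: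
  assumes "finite S" "\<And>s. s \<in> S \<Longrightarrow> f s \<in> P i"
  shows "(\<Oplus>\<^bsub>G i\<^esub>s\<in>S. P (Suc i) +> f s) = P (Suc i) +> (\<Oplus>s\<in>S. f s) \<and> (\<Oplus>s\<in>S. f s) \<in> P i"
  using assms
proof (induction rule: finite_induct)
  case empty
  interpret V: vectorspace class_ring "G i" by (rule graded_piece_vectorspace)
  show ?case using coset_eq_zero_iff[OF ideal_P[of "Suc i"], of \<zero>] P_closed(1)
    by (simp add: graded_piece_fields)
next
  case (insert t S)
  interpret V: vectorspace class_ring "G i" by (rule graded_piece_vectorspace)
  have "(\<Oplus>\<^bsub>G i\<^esub>s\<in>insert t S. P (Suc i) +> f s) = (P (Suc i) +> f t) \<oplus>\<^bsub>G i\<^esub> (\<Oplus>\<^bsub>G i\<^esub>s\<in>S. P (Suc i) +> f s)"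
    using insert by (intro V.M.finsum_insert) (auto simp: graded_piece_fields)
  moreover have "(\<Oplus>s\<in>insert t S. f s) = f t \<oplus> (\<Oplus>s\<in>S. f s)"
    using insert P_carrier by (intro M.finsum_insert) auto
  ultimately show ?case using insert P_carrier[of _ i] by (simp add: graded_piece_add P_closed)
qed

text \<open>Changing the representatives by \<open>a\<close> and \<open>b\<close> from the next
  powers changes the product by \<open>a \<otimes> (b \<oplus> y) \<oplus> x \<otimes> b\<close>,
  which lies in \<open>P (Suc (i + j))\<close>. Hence the double union in \<open>graded_mult\<close>
  collapses to one coset.\<close>

lemma graded_mult_coset:
  assumes "x \<in> P i" "y \<in> P j"
  shows "graded_mult A \<mm> i j (P (Suc i) +> x) (P (Suc j) +> y) = P (Suc (i + j)) +> (x \<otimes> y)"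
proof -
  have "P (Suc (i + j)) +> (x' \<otimes> y') = P (Suc (i + j)) +> (x \<otimes> y)"
    if x': "x' \<in> P (Suc i) +> x" and y': "y' \<in> P (Suc j) +> y" for x' y'
  proof -
    obtain a where a: "a \<in> P (Suc i)" "x' = a \<oplus> x" using x' by (rule coset_memE)
    obtain b where b: "b \<in> P (Suc j)" "y' = b \<oplus> y" using y' by (rule coset_memE)
    have bj: "b \<in> P j" using b(1) P_Suc_subset by blast
    note c = P_carrier[OF a(1)] P_carrier[OF b(1)] P_carrier[OF assms(1)] P_carrier[OF assms(2)]
    have "x' \<otimes> y' \<ominus> x \<otimes> y = a \<otimes> (b \<oplus> y) \<oplus> x \<otimes> b"
    proof -
      have "x' \<otimes> y' = (a \<otimes> (b \<oplus> y) \<oplus> x \<otimes> b) \<oplus> x \<otimes> y"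
        unfolding a b using c by (simp add: l_distr r_distr M.a_ac)
      then show ?thesis using c by (simp add: a_minus_def M.a_assoc M.r_neg)
    qed
    also have "\<dots> \<in> P (Suc (i + j))"
      using P_mult[OF a(1) P_closed(2)[OF bj assms(2)]] P_mult[OF assms(1) b(1)] P_closed(2) by simp
    finally show ?thesis using coset_eq_iff[OF ideal_P[of "Suc (i + j)"]] c a b by simp
  qed
  then have "graded_mult A \<mm> i j (P (Suc i) +> x) (P (Suc j) +> y) =
      (\<Union>x'\<in>P (Suc i) +> x. \<Union>y'\<in>P (Suc j) +> y. P (Suc (i + j)) +> (x \<otimes> y))"
    unfolding graded_mult_def by (intro SUP_cong refl)
  moreover have "x \<in> P (Suc i) +> x" "y \<in> P (Suc j) +> y"
    using coset_self[OF ideal_P] P_carrier assms by blast+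
  ultimately show ?thesis by auto
qed

end

section \<open>Stable powers vanish under the descending chain condition\<close>

lemma (in artinian_ring) minimal_ideal_exists:
  assumes "ideal J R" "Q J"
  shows "\<exists>J'. ideal J' R \<and> Q J' \<and> (\<forall>L. ideal L R \<longrightarrow> Q L \<longrightarrow> \<not> L \<subset> J')"
proof (rule ccontr)
  assume "\<not> ?thesis"
  then have "\<exists>L. (ideal L R \<and> Q L) \<and> L \<subset> J'" if "ideal J' R \<and> Q J'" for J'
    using that by blast
  \<comment> \<open>Dependent choice turns the absence of a minimal ideal into a strictly descending
    chain of ideals.\<close>
  then have "\<exists>C. \<forall>k. (ideal (C k) R \<and> Q (C k)) \<and> C (Suc k) \<subset> C k"
    by (intro dependent_nat_choice[of "\<lambda>_ J. ideal J R \<and> Q J" "\<lambda>_ J L. L \<subset> J"]) (use assms in blast)+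
  then obtain C where C: "\<And>k. ideal (C k) R" "\<And>k. C (Suc k) \<subset> C k" by blast
  then obtain N where N: "\<forall>k\<ge>N. C k = C N" using descending_chain[of C] by auto
  have "C (Suc N) = C N" using N[rule_format, of "Suc N"] by simp
  then show False using C(2)[of N] by blast
qed

context adic_algebra
begin

text \<open>An ideal \<open>L\<close> minimal with $LJ\neq0$, where $J=\mathfrak m^i=J^2$, equals $aJ$ for some
  $a\in L$, so that $a=ay$ with $1-y$ a unit.\<close>

lemma stable_power_zero:
  assumes "artinian_ring A" and unit: "\<And>y. y \<in> \<mm> \<Longrightarrow> \<one> \<ominus> y \<in> Units A"
    and "P (Suc i) = P i" "i > 0"
  shows "P i = {\<zero>}"
proof (rule ccontr)
  assume "P i \<noteq> {\<zero>}"
  then obtain j where j: "j \<in> P i" "j \<noteq> \<zero>" using P_closed(1) by blast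
  define Q where "Q L \<longleftrightarrow> (\<exists>a\<in>L. \<exists>y\<in>P i. a \<otimes> y \<noteq> \<zero>)" for L
  have "Q (carrier A)" unfolding Q_def using j P_carrier by (intro bexI[of _ \<one>] bexI[of _ j]) auto
  then obtain L where "ideal L A \<and> Q L \<and> (\<forall>L'. ideal L' A \<longrightarrow> Q L' \<longrightarrow> \<not> L' \<subset> L)"
    using artinian_ring.minimal_ideal_exists[OF assms(1) oneideal, of Q] by iprover
  then have L: "ideal L A" "Q L" "\<And>L'. ideal L' A \<Longrightarrow> Q L' \<Longrightarrow> \<not> L' \<subset> L" by blast+
  then obtain a y where a: "a \<in> L" and y: "y \<in> P i" and ay: "a \<otimes> y \<noteq> \<zero>" unfolding Q_def by blast
  have ac: "a \<in> carrier A" using a L(1) by (rule ideal.Icarr[rotated])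
  define L' where "L' = (\<lambda>y. a \<otimes> y) ` P i"
  have idL': "ideal L' A"
  proof (rule idealI)
    show "subgroup L' (add_monoid A)"
    proof (rule M.add.subgroupI)
      show "L' \<subseteq> carrier A" unfolding L'_def using ac P_carrier by auto
      show "L' \<noteq> {}" unfolding L'_def using y by blast
    next
      fix u assume "u \<in> L'"
      then obtain z where "z \<in> P i" "u = a \<otimes> z" unfolding L'_def by blast
      then have "\<ominus> u = a \<otimes> (\<ominus> z)" "\<ominus> z \<in> P i"
        using ac P_carrier[of z i] P_closed(3)[of z i] by (simp_all add: r_minus)
      then show "\<ominus> u \<in> L'" unfolding L'_def by blast
      fix v assume "v \<in> L'"
      then obtain w where "w \<in> P i" "v = a \<otimes> w" unfolding L'_def by blast
      then have "u \<oplus> v = a \<otimes> (z \<oplus> w)" "z \<oplus> w \<in> P i"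
        using \<open>z \<in> P i\<close> \<open>u = a \<otimes> z\<close> ac P_carrier[of _ i] P_closed(2)[of z i w] by (simp_all add: r_distr)
      then show "u \<oplus> v \<in> L'" unfolding L'_def by blast
    qed
  next
    fix u x assume "u \<in> L'" and x: "x \<in> carrier A"
    then obtain z where z: "z \<in> P i" "u = a \<otimes> z" unfolding L'_def by blast
    then have "x \<otimes> u = a \<otimes> (x \<otimes> z)" "x \<otimes> z \<in> P i"
      using ac x P_carrier[of z i] ideal.I_l_closed[OF ideal_P, of z i x] by (simp_all add: m_lcomm)
    then show "x \<otimes> u \<in> L'" unfolding L'_def by blast
    then show "u \<otimes> x \<in> L'" using z x ac P_carrier[of z i] by (simp add: m_comm)
  qed (rule ring_axioms)
  have "L' \<subseteq> L" unfolding L'_def using ideal.I_r_closed[OF L(1) a] P_carrier by blast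
  moreover have "Q L'"
  proof (rule ccontr)
    assume "\<not> Q L'"
    then have "a \<otimes> u \<otimes> v = \<zero>" if "u \<in> P i" "v \<in> P i" for u v
      using that unfolding Q_def L'_def by blast
    then have z: "a \<otimes> (u \<otimes> v) = \<zero>" if "u \<in> P i" "v \<in> P i" for u v
      using that m_assoc[OF ac P_carrier[OF that(1)] P_carrier[OF that(2)]] by simp
    \<comment> \<open>Being annihilated by \<open>a\<close> is an additive condition, so it passes
      from products of two elements to the whole product ideal. By stability that ideal is
      \<open>P i\<close> itself, which contains \<open>y\<close>.\<close>
    have "a \<otimes> u = \<zero>" if "u \<in> ideal_prod A (P i) (P i)" for u
      using that
    proof induction
      case (sum u v)
      have "ideal_prod A (P i) (P i) \<subseteq> carrier A" by (intro ideal_prod_in_carrier ideal_P)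
      then have "u \<in> carrier A" "v \<in> carrier A" using sum by blast+
      then show ?case using sum ac by (simp add: r_distr)
    qed (rule z)
    moreover have "ideal_prod A (P i) (P i) = P i" using P_stable[OF assms(3), of i] P_add[of i i] by simp
    ultimately show False using ay y by blast
  qed
  ultimately have "L' = L" using L(3)[OF idL'] by blast
  then obtain z where z: "z \<in> P i" "a = a \<otimes> z" using a unfolding L'_def by blast
  have zc: "z \<in> carrier A" using z P_carrier by blast
  have "P i \<subseteq> \<mm>" using P_antimono[of "Suc 0" i] assms(4) P_one by simp
  then have u: "\<one> \<ominus> z \<in> Units A" using unit z by blast
  have "a \<otimes> (\<one> \<ominus> z) = a \<ominus> a \<otimes> z" using ac zc by (simp add: a_minus_def r_distr r_minus)
  also have "\<dots> = \<zero>" using ac by (simp add: z(2)[symmetric] a_minus_def M.r_neg)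
  finally have "a \<otimes> (\<one> \<ominus> z) \<otimes> inv (\<one> \<ominus> z) = \<zero>" using u by simp
  then have "a = \<zero>" using u ac m_assoc[OF ac Units_closed[OF u] Units_inv_closed[OF u]] by simp
  then show False using ay P_carrier[OF y] by simp
qed

end

section \<open>Algebras graded compatibly with the adic filtration\<close>

context adic_algebra
begin

text \<open>The series of the \<open>p i\<close> converges to \<open>a\<close> in the adic topology.
  Stating the decomposition by partial sums avoids fixing in advance how many homogeneous components
  there are, and lets each degree be treated by induction.\<close>

definition parts :: "(nat \<Rightarrow> 'a set) \<Rightarrow> 'a \<Rightarrow> (nat \<Rightarrow> 'a) \<Rightarrow> bool" where
  "parts C a p \<longleftrightarrow> (\<forall>i. p i \<in> C i) \<and> (\<forall>k. a \<ominus> (\<Oplus>i\<in>{..<k}. p i) \<in> P k)"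

lemma finsum_lessThan_Suc:
  "(\<And>i. p i \<in> carrier A) \<Longrightarrow> (\<Oplus>i\<in>{..<Suc k}. p i) = p k \<oplus> (\<Oplus>i\<in>{..<k}. p i)"
  unfolding lessThan_Suc by (subst M.finsum_insert) auto

lemma P_finsum: "finite S \<Longrightarrow> (\<And>s. s \<in> S \<Longrightarrow> f s \<in> P i) \<Longrightarrow> (\<Oplus>s\<in>S. f s) \<in> P i"
  using graded_piece_finsum by blast

text \<open>The difference consists of the terms of index at least \<open>n\<close>, all of which
  lie in \<open>P n\<close>.\<close>

lemma finsum_lessThan_diff:
  assumes "\<And>i. p i \<in> P i" "n \<le> k"
  shows "(\<Oplus>i\<in>{..<k}. p i) \<ominus> (\<Oplus>i\<in>{..<n}. p i) \<in> P n"
  using assms(2)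
proof (induction k rule: dec_induct)
  case base
  have "(\<Oplus>i\<in>{..<n}. p i) \<in> carrier A" using assms P_carrier by (intro M.finsum_closed) auto
  then show ?case using P_closed(1) by (simp add: a_minus_def M.r_neg)
next
  case (step k)
  have c: "p i \<in> carrier A" for i using assms(1) by (rule P_carrier)
  have s: "(\<Oplus>i\<in>{..<l}. p i) \<in> carrier A" for l using c by (intro M.finsum_closed) auto
  have "p k \<in> P n" using assms(1)[of k] P_antimono[OF step(1)] by blast
  then have "p k \<oplus> ((\<Oplus>i\<in>{..<k}. p i) \<ominus> (\<Oplus>i\<in>{..<n}. p i)) \<in> P n"
    by (rule P_closed(2)[OF _ step.IH])
  then show ?case using c s by (simp add: finsum_lessThan_Suc a_minus_def M.a_assoc)
qed

text \<open>\<open>C_span\<close> and \<open>C_indep\<close> together say that \<open>C i\<close> is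
  a complement of \<open>P (Suc i)\<close> in \<open>P i\<close>, so that it maps isomorphically
  onto the graded piece of degree \<open>i\<close>. \<open>C_mult\<close> and \<open>C_one\<close>
  make these complements compatible with the ring structure.\<close>

context
  fixes C :: "nat \<Rightarrow> 'a set"
  assumes C_submodule: "\<And>i. submodule class_ring (C i) A"
    and C_mult: "\<And>i j x y. x \<in> C i \<Longrightarrow> y \<in> C j \<Longrightarrow> x \<otimes> y \<in> C (i + j)"
    and C_one: "\<one> \<in> C 0"
    and C_subset: "\<And>i. C i \<subseteq> P i"
    and C_span: "\<And>i a. a \<in> P i \<Longrightarrow> \<exists>c\<in>C i. a \<ominus> c \<in> P (Suc i)"
    and C_indep: "\<And>i x. x \<in> C i \<Longrightarrow> x \<in> P (Suc i) \<Longrightarrow> x = \<zero>"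
begin

lemma C_carrier: "x \<in> C i \<Longrightarrow> x \<in> carrier A"
  using C_subset P_carrier by blast

lemma C_closed:
  "x \<in> C i \<Longrightarrow> y \<in> C i \<Longrightarrow> x \<oplus> y \<in> C i"
  "x \<in> C i \<Longrightarrow> c \<odot> x \<in> C i"
  "\<zero> \<in> C i"
  "x \<in> C i \<Longrightarrow> \<ominus> x \<in> C i"
  "x \<in> C i \<Longrightarrow> y \<in> C i \<Longrightarrow> x \<ominus> y \<in> C i"
proof -
  interpret C: submodule class_ring "C i" A by (rule C_submodule)
  show a: "x \<in> C i \<Longrightarrow> y \<in> C i \<Longrightarrow> x \<oplus> y \<in> C i" for x y by (rule C.m_closed)
  show s: "x \<in> C i \<Longrightarrow> c \<odot> x \<in> C i" for x c by (rule C.smult_closed) simp_all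
  show "\<zero> \<in> C i" by (rule C.zero_closed)
  show n: "x \<in> C i \<Longrightarrow> \<ominus> x \<in> C i" for x
    using s[of x "-1"] C_carrier[of x i] K_smult_l_minus[of x 1] by simp
  show "x \<in> C i \<Longrightarrow> y \<in> C i \<Longrightarrow> x \<ominus> y \<in> C i"
    unfolding a_minus_def by (intro a n)
qed

lemma C_finsum: "finite S \<Longrightarrow> (\<And>s. s \<in> S \<Longrightarrow> f s \<in> C i) \<Longrightarrow> (\<Oplus>s\<in>S. f s) \<in> C i"
proof (induction rule: finite_induct)
  case (insert t S)
  then have "(\<Oplus>s\<in>insert t S. f s) = f t \<oplus> (\<Oplus>s\<in>S. f s)"
    using C_carrier[of _ i] by (intro M.finsum_insert) auto
  then show ?case using insert C_closed(1) by simp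
qed (simp add: C_closed(3))

lemma parts_C: "parts C a p \<Longrightarrow> p i \<in> C i"
  by (simp add: parts_def)

lemma parts_P: "parts C a p \<Longrightarrow> p i \<in> P i"
  using parts_C C_subset by blast

lemma parts_carrier: "parts C a p \<Longrightarrow> p i \<in> carrier A"
  by (rule C_carrier[OF parts_C])

lemma parts_sum_carrier: "parts C a p \<Longrightarrow> (\<Oplus>i\<in>{..<k}. p i) \<in> carrier A"
  by (rule M.finsum_closed) (auto intro: parts_carrier)

lemma parts_diff: "parts C a p \<Longrightarrow> a \<ominus> (\<Oplus>i\<in>{..<k}. p i) \<in> P k"
  by (simp add: parts_def)

lemma parts_exists:
  assumes "a \<in> carrier A"
  shows "\<exists>p. parts C a p"
proof -
  define c where "c k x = (SOME y. y \<in> C k \<and> x \<ominus> y \<in> P (Suc k))" for k x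
  have c: "c k x \<in> C k" "x \<ominus> c k x \<in> P (Suc k)" if "x \<in> P k" for k x
    using someI_ex[of "\<lambda>y. y \<in> C k \<and> x \<ominus> y \<in> P (Suc k)"] C_span[OF that] unfolding c_def by blast+
  \<comment> \<open>Successive approximation: \<open>r k\<close> is the remainder in
    \<open>P k\<close>, from which its component in \<open>C k\<close> is removed to reach
    \<open>P (Suc k)\<close>.\<close>
  define r where "r = rec_nat a (\<lambda>k x. x \<ominus> c k x)"
  have r: "r 0 = a" "r (Suc k) = r k \<ominus> c k (r k)" for k by (simp_all add: r_def)
  have rP: "r k \<in> P k" for k by (induction k) (use assms c r in auto)
  let ?p = "\<lambda>k. c k (r k)"
  have p: "?p k \<in> C k" "?p k \<in> carrier A" for k using c rP C_carrier by blast+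
  have "a \<ominus> (\<Oplus>i\<in>{..<k}. ?p i) = r k" for k
  proof (induction k)
    case (Suc k)
    have s: "(\<Oplus>i\<in>{..<k}. ?p i) \<in> carrier A" using p by (intro M.finsum_closed) auto
    have "a \<ominus> (\<Oplus>i\<in>{..<Suc k}. ?p i) = (a \<ominus> (\<Oplus>i\<in>{..<k}. ?p i)) \<ominus> ?p k"
      unfolding finsum_lessThan_Suc[of ?p, OF p(2)]
      using s p(2)[of k] assms by (simp add: a_minus_def M.minus_add M.a_ac)
    then show ?case unfolding Suc r .
  qed (use assms r in \<open>simp add: a_minus_def\<close>)
  then show ?thesis unfolding parts_def using p rP by (intro exI[of _ ?p]) simp
qed

text \<open>Once the parts below \<open>k\<close> agree, subtracting the two remainders leaves
  \<open>p k \<ominus> q k\<close>, an element of both \<open>C k\<close> and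
  \<open>P (Suc k)\<close>.\<close>

lemma parts_unique:
  assumes "parts C a p" "parts C a q" "a \<in> carrier A"
  shows "p = q"
proof
  fix k
  show "p k = q k"
  proof (induction k rule: less_induct)
    case (less k)
    have eq: "(\<Oplus>i\<in>{..<k}. q i) = (\<Oplus>i\<in>{..<k}. p i)"
      using less parts_carrier[OF assms(1)] by (intro M.finsum_cong') auto
    note c = parts_carrier[OF assms(1), of k] parts_carrier[OF assms(2), of k] parts_sum_carrier[OF assms(1), of k] assms(3)
    have "(a \<ominus> (\<Oplus>i\<in>{..<Suc k}. q i)) \<ominus> (a \<ominus> (\<Oplus>i\<in>{..<Suc k}. p i)) = p k \<ominus> q k"
      unfolding finsum_lessThan_Suc[of p, OF parts_carrier[OF assms(1)]]
        finsum_lessThan_Suc[of q, OF parts_carrier[OF assms(2)]] eq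
      using c by algebra
    then have "p k \<ominus> q k \<in> P (Suc k)"
      using P_closed(4)[OF parts_diff[OF assms(2)] parts_diff[OF assms(1)], of "Suc k"] by simp
    then have "p k \<ominus> q k = \<zero>" using C_indep[of "p k \<ominus> q k" k] C_closed(5) parts_C assms by blast
    then show "p k = q k" using c(1,2) by simp
  qed
qed

lemma parts_add:
  assumes "parts C a p" "parts C b q" "a \<in> carrier A" "b \<in> carrier A"
  shows "parts C (a \<oplus> b) (\<lambda>i. p i \<oplus> q i)"
proof -
  have "a \<oplus> b \<ominus> (\<Oplus>i\<in>{..<k}. p i \<oplus> q i) = (a \<ominus> (\<Oplus>i\<in>{..<k}. p i)) \<oplus> (b \<ominus> (\<Oplus>i\<in>{..<k}. q i))" for k
    using parts_carrier[OF assms(1)] parts_carrier[OF assms(2)] parts_sum_carrier[OF assms(1)]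
      parts_sum_carrier[OF assms(2)] assms(3,4)
    by (subst M.finsum_addf) (auto simp: a_minus_def M.minus_add M.a_ac)
  then show ?thesis unfolding parts_def
    using assms(1,2) parts_C C_closed(1) parts_diff P_closed(2) by auto
qed

lemma parts_smult:
  assumes "parts C a p" "a \<in> carrier A"
  shows "parts C (c \<odot> a) (\<lambda>i. c \<odot> p i)"
proof -
  have "c \<odot> a \<ominus> (\<Oplus>i\<in>{..<k}. c \<odot> p i) = c \<odot> (a \<ominus> (\<Oplus>i\<in>{..<k}. p i))" for k
    using finsum_smult_ldistr[of "{..<k}" c p] parts_carrier[OF assms(1)] parts_sum_carrier[OF assms(1)] assms(2)
    by (simp add: K_smult_diff)
  then show ?thesis unfolding parts_def
    using assms(1) parts_C C_closed(2) parts_diff P_closed(5) by auto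
qed

lemma parts_one: "parts C \<one> (\<lambda>i. if i = 0 then \<one> else \<zero>)"
proof -
  have "(\<Oplus>i\<in>{..<k}. if i = 0 then \<one> else \<zero>) = (if k = 0 then \<zero> else \<one>)" for k :: nat
    by (induction k) (auto simp: finsum_lessThan_Suc)
  then show ?thesis unfolding parts_def using C_one C_closed(3) P_closed(1)
    by (auto simp: a_minus_def M.r_neg)
qed

text \<open>The Cauchy product of the parts approximates the product because the terms it omits have
  total degree at least \<open>k\<close>. These omitted terms are gathered in an exact error
  \<open>t k\<close>, so that no double sum has to be rearranged.\<close>

lemma parts_mult:
  assumes "parts C a p" "parts C b q" "a \<in> carrier A" "b \<in> carrier A"
  shows "parts C (a \<otimes> b) (\<lambda>k. \<Oplus>i\<in>{..k}. p i \<otimes> q (k - i))"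
proof -
  note pc [simp] = parts_carrier[OF assms(1)] and qc [simp] = parts_carrier[OF assms(2)]
  note ps [simp] = parts_sum_carrier[OF assms(1)] and qs [simp] = parts_sum_carrier[OF assms(2)]
  note [simp] = assms(3,4)
  \<comment> \<open>The range \<open>{..<Suc k}\<close> stands for \<open>{..k}\<close>, so that
    \<open>r k\<close> and \<open>t (Suc k)\<close> are sums over the same indices and can be added
    term by term.\<close>
  define r where "r k = (\<Oplus>i\<in>{..<Suc k}. p i \<otimes> q (k - i))" for k
  define t where "t k = (\<Oplus>i\<in>{..<k}. p i \<otimes> (b \<ominus> (\<Oplus>j\<in>{..<k - i}. q j)))" for k
  have rc [simp]: "r k \<in> carrier A" for k unfolding r_def by (rule M.finsum_closed) auto
  have tc [simp]: "t k \<in> carrier A" for k unfolding t_def by (rule M.finsum_closed) auto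
  have rs [simp]: "(\<Oplus>j\<in>{..<k}. r j) \<in> carrier A" for k by (rule M.finsum_closed) auto
  \<comment> \<open>Adding \<open>q (k - i)\<close> to the remainder of \<open>b\<close> after
    \<open>Suc k - i\<close> parts gives back the remainder after \<open>k - i\<close> parts. For
    \<open>i = k\<close> no parts are left and the term is \<open>p k \<otimes> b\<close>.\<close>
  have rt: "r k \<oplus> t (Suc k) = p k \<otimes> b \<oplus> t k" for k
  proof -
    have "r k \<oplus> t (Suc k) =
        (\<Oplus>i\<in>{..<Suc k}. p i \<otimes> q (k - i) \<oplus> p i \<otimes> (b \<ominus> (\<Oplus>j\<in>{..<Suc k - i}. q j)))"
      unfolding r_def t_def by (rule M.finsum_addf[symmetric]) auto
    also have "\<dots> = (\<Oplus>i\<in>{..<Suc k}. p i \<otimes> (b \<ominus> (\<Oplus>j\<in>{..<k - i}. q j)))"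
    proof (rule M.finsum_cong')
      fix i assume "i \<in> {..<Suc k}"
      then have i: "Suc k - i = Suc (k - i)" by auto
      have "q (k - i) \<oplus> (b \<ominus> (q (k - i) \<oplus> (\<Oplus>j\<in>{..<k - i}. q j))) = b \<ominus> (\<Oplus>j\<in>{..<k - i}. q j)"
        by (simp add: a_minus_def M.minus_add M.a_lcomm[of b] M.r_neg2)
      then show "p i \<otimes> q (k - i) \<oplus> p i \<otimes> (b \<ominus> (\<Oplus>j\<in>{..<Suc k - i}. q j)) =
          p i \<otimes> (b \<ominus> (\<Oplus>j\<in>{..<k - i}. q j))"
        unfolding i finsum_lessThan_Suc[of q, OF qc] by (subst r_distr[symmetric]) auto
    qed auto
    also have "\<dots> = p k \<otimes> b \<oplus> t k"
      by (subst finsum_lessThan_Suc) (auto simp: t_def a_minus_def)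
    finally show ?thesis .
  qed
  have E: "(\<Oplus>j\<in>{..<k}. r j) \<oplus> t k = (\<Oplus>i\<in>{..<k}. p i) \<otimes> b" for k
  proof (induction k)
    case 0
    then show ?case by (simp add: t_def)
  next
    case (Suc k)
    have "(\<Oplus>j\<in>{..<Suc k}. r j) \<oplus> t (Suc k) = (\<Oplus>j\<in>{..<k}. r j) \<oplus> (r k \<oplus> t (Suc k))"
      by (simp add: finsum_lessThan_Suc M.a_ac)
    also have "\<dots> = p k \<otimes> b \<oplus> ((\<Oplus>j\<in>{..<k}. r j) \<oplus> t k)"
      unfolding rt by (simp add: M.a_ac)
    also have "\<dots> = (\<Oplus>i\<in>{..<Suc k}. p i) \<otimes> b"
      unfolding Suc by (simp add: finsum_lessThan_Suc l_distr)
    finally show ?case .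
  qed
  have "a \<otimes> b \<ominus> (\<Oplus>j\<in>{..<k}. r j) \<in> P k" for k
  proof -
    have "a \<otimes> b \<ominus> (\<Oplus>j\<in>{..<k}. r j) = (a \<ominus> (\<Oplus>i\<in>{..<k}. p i)) \<otimes> b \<oplus> t k"
    proof -
      have "(a \<ominus> (\<Oplus>i\<in>{..<k}. p i)) \<otimes> b \<oplus> t k = a \<otimes> b \<ominus> ((\<Oplus>j\<in>{..<k}. r j) \<oplus> t k) \<oplus> t k"
        unfolding E by (simp add: a_minus_def l_distr l_minus)
      also have "\<dots> = a \<otimes> b \<ominus> (\<Oplus>j\<in>{..<k}. r j)"
        by (simp add: a_minus_def M.minus_add M.a_assoc M.l_neg)
      finally show ?thesis ..
    qed
    moreover have "(a \<ominus> (\<Oplus>i\<in>{..<k}. p i)) \<otimes> b \<in> P k"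
      using parts_diff[OF assms(1)] ideal.I_r_closed[OF ideal_P] by simp
    moreover have "t k \<in> P k"
      unfolding t_def
    \<comment> \<open>Each term of the error is a part in \<open>P i\<close> times a remainder of
      \<open>b\<close> in \<open>P (k - i)\<close>.\<close>
    proof (rule P_finsum)
      fix i assume i: "i \<in> {..<k}"
      show "p i \<otimes> (b \<ominus> (\<Oplus>j\<in>{..<k - i}. q j)) \<in> P k"
        using P_mult[OF parts_P[OF assms(1)] parts_diff[OF assms(2)], of i "k - i"] i by simp
    qed simp
    ultimately show ?thesis using P_closed(2) by simp
  qed
  moreover have "r k \<in> C k" for k
    unfolding r_def
  proof (rule C_finsum)
    fix i assume "i \<in> {..<Suc k}"
    then show "p i \<otimes> q (k - i) \<in> C k"
      using C_mult[OF parts_C[OF assms(1)] parts_C[OF assms(2)], of i "k - i"] by simp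
  qed simp
  ultimately show ?thesis unfolding parts_def r_def lessThan_Suc_atMost by blast
qed

lemma finsum_graded_mult:
  assumes "parts C a p" "parts C b q"
  shows "(\<Oplus>\<^bsub>G k\<^esub>i\<in>{..k}. graded_mult A \<mm> i (k - i) (P (Suc i) +> p i) (P (Suc (k - i)) +> q (k - i))) =
    P (Suc k) +> (\<Oplus>i\<in>{..k}. p i \<otimes> q (k - i))"
proof -
  interpret V: vectorspace class_ring "G k" by (rule graded_piece_vectorspace)
  have P: "p i \<otimes> q (k - i) \<in> P k" if "i \<le> k" for i
    using P_mult[OF parts_P[OF assms(1)] parts_P[OF assms(2)], of i "k - i"] that by simp
  have "(\<Oplus>\<^bsub>G k\<^esub>i\<in>{..k}. graded_mult A \<mm> i (k - i) (P (Suc i) +> p i) (P (Suc (k - i)) +> q (k - i))) =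
      (\<Oplus>\<^bsub>G k\<^esub>i\<in>{..k}. P (Suc k) +> (p i \<otimes> q (k - i)))"
  proof (rule V.M.finsum_cong')
    show "(\<lambda>i. P (Suc k) +> (p i \<otimes> q (k - i))) \<in> {..k} \<rightarrow> carrier (G k)"
      unfolding graded_piece_fields using P by auto
    fix i assume "i \<in> {..k}"
    then show "graded_mult A \<mm> i (k - i) (P (Suc i) +> p i) (P (Suc (k - i)) +> q (k - i)) =
        P (Suc k) +> (p i \<otimes> q (k - i))"
      using graded_mult_coset[OF parts_P[OF assms(1)] parts_P[OF assms(2)], of i "k - i"] by simp
  qed simp
  also have "\<dots> = P (Suc k) +> (\<Oplus>i\<in>{..k}. p i \<otimes> q (k - i))"
    using graded_piece_finsum[of "{..k}" "\<lambda>i. p i \<otimes> q (k - i)" k] P by simp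
  finally show ?thesis .
qed

text \<open>The isomorphism sends an element to the sequence of classes of its parts. It respects
  the operations because parts are unique. It is injective because equal classes force equal parts,
  and an element is the sum of its first \<open>N\<close> parts; it is surjective because every
  class has a representative in \<open>C i\<close>.\<close>

lemma canonically_gradedI:
  assumes nil: "P N = {\<zero>}"
  shows "canonically_graded class_ring A \<mm>"
proof -
  define pr where "pr a = (THE p. parts C a p)" for a
  have pr: "parts C a (pr a)" if a: "a \<in> carrier A" for a
  proof -
    obtain p where p: "parts C a p" using parts_exists[OF a] by blast
    show ?thesis unfolding pr_def by (rule theI[of "parts C a", OF p parts_unique[OF _ p a]])
  qed
  have pr_eq: "pr a = p" if "parts C a p" "a \<in> carrier A" for a p
    using pr that parts_unique by blast
  define h where "h a i = P (Suc i) +> pr a i" for a i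
  \<comment> \<open>Nilpotency gives the finite support that membership in
    \<open>assoc_graded\<close> demands.\<close>
  have eventually_zero: "p i = \<zero>" if "parts C a p" "N \<le> i" for a p i
    using parts_P[OF that(1), of i] P_antimono[OF that(2)] nil by blast
  have hom: "h \<in> Ring.ring_hom A (assoc_graded A \<mm>)"
  proof (rule ring_hom_memI)
    fix a assume a: "a \<in> carrier A"
    have "{i. h a i \<noteq> P (Suc i)} \<subseteq> {..<N}"
      using eventually_zero[OF pr[OF a]] coset_eq_zero_iff[OF ideal_P] P_closed(1)
      by (force simp: h_def not_less[symmetric])
    then have "finite {i. h a i \<noteq> P (Suc i)}" by (rule finite_subset) simp
    then show "h a \<in> carrier (assoc_graded A \<mm>)"
      using parts_P[OF pr[OF a]] by (simp add: assoc_graded_def graded_piece_fields h_def)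
    fix b assume b: "b \<in> carrier A"
    have "pr (a \<otimes> b) = (\<lambda>k. \<Oplus>i\<in>{..k}. pr a i \<otimes> pr b (k - i))"
      by (rule pr_eq[OF parts_mult[OF pr[OF a] pr[OF b] a b]]) (use a b in simp)
    then show "h (a \<otimes> b) = h a \<otimes>\<^bsub>assoc_graded A \<mm>\<^esub> h b"
      by (simp add: assoc_graded_def h_def finsum_graded_mult[OF pr[OF a] pr[OF b]] fun_eq_iff)
    have "pr (a \<oplus> b) = (\<lambda>i. pr a i \<oplus> pr b i)"
      by (rule pr_eq[OF parts_add[OF pr[OF a] pr[OF b] a b]]) (use a b in simp)
    then show "h (a \<oplus> b) = h a \<oplus>\<^bsub>assoc_graded A \<mm>\<^esub> h b"
      by (simp add: assoc_graded_def h_def graded_piece_add parts_carrier[OF pr[OF a]] parts_carrier[OF pr[OF b]] fun_eq_iff)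
  next
    have "pr \<one> = (\<lambda>i. if i = 0 then \<one> else \<zero>)" by (rule pr_eq[OF parts_one]) simp
    then show "h \<one> = \<one>\<^bsub>assoc_graded A \<mm>\<^esub>"
      using coset_eq_zero_iff[OF ideal_P] P_closed(1)
      by (auto simp: assoc_graded_def h_def graded_piece_fields fun_eq_iff)
  qed
  have inj: "inj_on h (carrier A)"
  proof (rule inj_onI)
    fix a b assume a: "a \<in> carrier A" and b: "b \<in> carrier A" and eq: "h a = h b"
    have "pr a i = pr b i" for i
    proof -
      have c: "pr a i \<in> carrier A" "pr b i \<in> carrier A"
        using parts_carrier[OF pr[OF a]] parts_carrier[OF pr[OF b]] by blast+
      have "pr a i \<ominus> pr b i \<in> P (Suc i)"
        using fun_cong[OF eq, of i] coset_eq_iff[OF ideal_P c] unfolding h_def by blast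
      then have "pr a i \<ominus> pr b i = \<zero>"
        using C_indep[of "pr a i \<ominus> pr b i" i] C_closed(5) parts_C[OF pr[OF a]] parts_C[OF pr[OF b]] by blast
      then show ?thesis using c by simp
    qed
    then have "pr a = pr b" by auto
    then have "a \<ominus> (\<Oplus>i\<in>{..<N}. pr a i) = \<zero>" "b \<ominus> (\<Oplus>i\<in>{..<N}. pr a i) = \<zero>"
      using parts_diff[OF pr[OF a], of N] parts_diff[OF pr[OF b], of N] nil by auto
    then show "a = b" using a b parts_sum_carrier[OF pr[OF a], of N] by simp
  qed
  have surj: "u \<in> h ` carrier A" if u: "u \<in> carrier (assoc_graded A \<mm>)" for u
  proof -
    have "\<exists>c\<in>C i. u i = P (Suc i) +> c" for i
    proof -
      obtain x where x: "x \<in> P i" "u i = P (Suc i) +> x"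
        using u by (auto simp: assoc_graded_def graded_piece_fields)
      obtain c where c: "c \<in> C i" "x \<ominus> c \<in> P (Suc i)" using C_span[OF x(1)] by blast
      then show ?thesis
        using x coset_eq_iff[OF ideal_P P_carrier[OF x(1)] C_carrier[OF c(1)]] by metis
    qed
    then obtain c where c: "\<And>i. c i \<in> C i" "\<And>i. u i = P (Suc i) +> c i" by metis
    have cP: "c i \<in> P i" and cc: "c i \<in> carrier A" for i using c(1) C_subset C_carrier by blast+
    let ?s = "\<lambda>k. \<Oplus>i\<in>{..<k}. c i"
    have sc: "?s k \<in> carrier A" for k by (rule M.finsum_closed) (simp add: cc)
    \<comment> \<open>Beyond \<open>N\<close> the partial sums are stationary, their differences
      lying in \<open>P N\<close>; so the sum of the first \<open>N\<close> representatives already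
      has all of \<open>c\<close> as its parts.\<close>
    have "?s N \<ominus> ?s k \<in> P k" for k
    proof (cases "k \<le> N")
      case True
      then show ?thesis using finsum_lessThan_diff[of c k N] cP by simp
    next
      case False
      then have "?s k \<ominus> ?s N = \<zero>" using finsum_lessThan_diff[of c N k] cP nil by simp
      then have "?s k = ?s N" using sc by simp
      then show ?thesis using sc[of N] P_closed(1) by (simp add: a_minus_def M.r_neg)
    qed
    then have "parts C (?s N) c" unfolding parts_def using c(1) by blast
    then have "h (?s N) = u" using pr_eq[OF _ sc] c(2) by (auto simp: h_def)
    then show ?thesis using sc by blast
  qed
  have smult: "h (c \<odot> a) = c \<odot>\<^bsub>assoc_graded A \<mm>\<^esub> h a" if a: "a \<in> carrier A" for c a
  proof -
    have "pr (c \<odot> a) = (\<lambda>i. c \<odot> pr a i)"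
      by (rule pr_eq[OF parts_smult[OF pr[OF a] a]]) (use a in simp)
    then show ?thesis
      by (simp add: assoc_graded_def h_def graded_piece_smult parts_carrier[OF pr[OF a]] fun_eq_iff)
  qed
  have "bij_betw h (carrier A) (carrier (assoc_graded A \<mm>))"
    unfolding bij_betw_def using inj surj ring_hom_closed[OF hom] by (intro conjI equalityI subsetI) auto
  then have "h \<in> alg_iso class_ring A (assoc_graded A \<mm>)"
    unfolding alg_iso_def ring_iso_def using hom smult by simp
  then show ?thesis unfolding canonically_graded_def by blast
qed

end

end

section \<open>Bases and finite generation\<close>

text \<open>A basis indexed by a prescribed set: by the type of the variables in degree 2, which
  turns coordinates into vectors of \<open>'k^'n\<close>, and by a one-point set for one-dimensional
  spaces.\<close>

lemma (in vectorspace) basis_family: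
  assumes "fin_dim" "finite S" "card S = dim"
  shows "\<exists>b. b \<in> S \<rightarrow> carrier V \<and>
    (\<forall>v\<in>carrier V. \<exists>c\<in>S \<rightarrow> carrier K. v = (\<Oplus>\<^bsub>V\<^esub>i\<in>S. c i \<odot>\<^bsub>V\<^esub> b i)) \<and>
    (\<forall>c\<in>S \<rightarrow> carrier K. (\<Oplus>\<^bsub>V\<^esub>i\<in>S. c i \<odot>\<^bsub>V\<^esub> b i) = \<zero>\<^bsub>V\<^esub> \<longrightarrow> (\<forall>i\<in>S. c i = \<zero>\<^bsub>K\<^esub>))"
proof -
  obtain B where fB: "finite B" and B: "basis B" using finite_basis_exists[OF assms(1)] by (elim exE conjE)
  have Bc: "B \<subseteq> carrier V" and li: "\<not> lin_dep B" and gen: "span B = carrier V"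
    using B by (simp_all add: basis_def)
  have "card S = card B" using dim_basis[OF fB B] assms(3) by simp
  then obtain f where f: "bij_betw f S B" using finite_same_card_bij[OF assms(2) fB] by blast
  have inj: "inj_on f S" and img: "f ` S = B" using f by (auto simp: bij_betw_def)
  have fc: "f i \<in> carrier V" if "i \<in> S" for i using that img Bc by blast
  have lc: "lincomb a B = (\<Oplus>\<^bsub>V\<^esub>i\<in>S. a (f i) \<odot>\<^bsub>V\<^esub> f i)" if "a \<in> B \<rightarrow> carrier K" for a
    unfolding lincomb_def img[symmetric] using that inj fc img by (intro M.finsum_reindex) auto
  have "\<exists>c\<in>S \<rightarrow> carrier K. v = (\<Oplus>\<^bsub>V\<^esub>i\<in>S. c i \<odot>\<^bsub>V\<^esub> f i)" if v: "v \<in> carrier V" for v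
  proof -
    obtain a where a: "a \<in> B \<rightarrow> carrier K" "v = lincomb a B"
      using v gen finite_span[OF fB Bc] by blast
    show ?thesis
      using a lc[OF a(1)] img by (intro bexI[of _ "\<lambda>i. a (f i)"]) auto
  qed
  moreover have "\<forall>i\<in>S. c i = \<zero>\<^bsub>K\<^esub>"
    if c: "c \<in> S \<rightarrow> carrier K" and z: "(\<Oplus>\<^bsub>V\<^esub>i\<in>S. c i \<odot>\<^bsub>V\<^esub> f i) = \<zero>\<^bsub>V\<^esub>" for c
  proof -
    let ?a = "\<lambda>v. c (the_inv_into S f v)"
    have inv: "the_inv_into S f (f i) = i" if "i \<in> S" for i
      using the_inv_into_f_f[OF inj that] .
    have a: "?a \<in> B \<rightarrow> carrier K" using c img inv by auto
    have "lincomb ?a B = (\<Oplus>\<^bsub>V\<^esub>i\<in>S. c i \<odot>\<^bsub>V\<^esub> f i)"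
      unfolding lc[OF a] using c fc inv by (intro M.finsum_cong') auto
    then have "?a \<in> B \<rightarrow> {\<zero>\<^bsub>K\<^esub>}" using not_lindepD[OF li fB subset_refl a] z by simp
    then have "?a (f i) = \<zero>\<^bsub>K\<^esub>" if "i \<in> S" for i using img that by blast
    then show ?thesis using inv by simp
  qed
  ultimately show ?thesis using fc by (intro exI[of _ f]) auto
qed

text \<open>Independent subsets of \<open>W\<close> stay independent in the whole space, so their
  size is bounded and a maximal one is a basis of \<open>W\<close>. This is needed for the socle,
  since \<open>dim\<close> yields a basis only together with \<open>fin_dim\<close>.\<close>

lemma (in vectorspace) submodule_fin_dim:
  assumes "fin_dim" "submodule K W V"
  shows "vectorspace.fin_dim K (V\<lparr>carrier := W\<rparr>)"
proof -
  have W: "W \<subseteq> carrier V" using assms(2) by (simp add: submodule_def)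
  interpret W: vectorspace K "V\<lparr>carrier := W\<rparr>"
    by (rule subspace_is_vs) (simp add: subspace_def assms(2) vectorspace_axioms)
  let ?Q = "\<lambda>S. S \<subseteq> carrier (V\<lparr>carrier := W\<rparr>) \<and> W.lin_indpt S"
  have bound: "finite S \<and> card S \<le> dim" if "?Q S" for S
  proof -
    have S: "S \<subseteq> W" "W.lin_indpt S" using that by simp_all
    then have "lin_indpt S" using span_li_not_depend(2)[OF S(1) assms(2)] by simp
    then show ?thesis using li_le_dim[OF assms(1)] S(1) W by blast
  qed
  have empty: "?Q {}" by (auto simp: W.lin_dep_def)
  have "\<exists>B. finite B \<and> maximal B ?Q"
    by (rule maximal_exists[where N = dim and B = "{}"]) (rule bound, assumption, rule empty)
  then obtain B where B: "finite B" "maximal B ?Q" by (elim exE conjE)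
  then have "W.basis B" by (intro W.max_li_is_basis)
  then show ?thesis unfolding W.fin_dim_def W.basis_def using B(1) by (intro exI[of _ B] conjI) simp_all
qed

text \<open>What the argument retains of the power series ring: the ideal is generated by finitely
  many elements, the classes of the variables, and every element is a scalar modulo the
  ideal.\<close>

locale generated_adic_algebra = adic_algebra A \<mm>
  for A :: "('k::field, 'a) module" (structure) and \<mm> +
  fixes x :: "'n::finite \<Rightarrow> 'a"
  assumes x_mem: "x i \<in> \<mm>"
    and m_generated: "a \<in> \<mm> \<Longrightarrow> \<exists>g. (\<forall>i. g i \<in> carrier A) \<and> a = (\<Oplus>i\<in>UNIV. x i \<otimes> g i)"
    and residue: "a \<in> carrier A \<Longrightarrow> \<exists>c. a \<ominus> c \<odot> \<one> \<in> \<mm>"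
begin

section \<open>Monomials span the graded pieces\<close>

primrec mon :: "nat \<Rightarrow> 'a set" where
  "mon 0 = {\<one>}"
| "mon (Suc k) = (\<lambda>(w, i). w \<otimes> x i) ` (mon k \<times> UNIV)"

lemma x_P: "x i \<in> P (Suc 0)"
  using x_mem P_one by simp

lemma x_carrier [simp]: "x i \<in> carrier A"
  using x_P P_carrier by blast

lemma finite_mon: "finite (mon k)"
  by (induction k) auto

lemma mon_P: "mon k \<subseteq> P k"
proof (induction k)
  case (Suc k)
  then show ?case using P_mult[of _ k "x _" "Suc 0"] x_P by auto
qed (use P_carrier in simp)

lemma mon_carrier: "mon k \<subseteq> carrier A"
  using mon_P P_carrier by blast

lemma submodule_closed:
  assumes "submodule class_ring H A"
  shows "y \<in> H \<Longrightarrow> z \<in> H \<Longrightarrow> y \<oplus> z \<in> H" "y \<in> H \<Longrightarrow> c \<odot> y \<in> H" "\<zero> \<in> H" "y \<in> H \<Longrightarrow> y \<in> carrier A"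
  using assms by (auto simp: submodule_def)

definition spanned :: "nat \<Rightarrow> 'a \<Rightarrow> bool" where
  "spanned k a \<longleftrightarrow> a \<in> P k \<and> (\<exists>v\<in>span (mon k). a \<ominus> v \<in> P (Suc k))"

lemma span_mon_P: "span (mon k) \<subseteq> P k"
  by (rule span_is_subset[OF mon_P ideal_submodule[OF ideal_P]])

lemma spanned_add: "spanned k a \<Longrightarrow> spanned k b \<Longrightarrow> spanned k (a \<oplus> b)"
proof -
  assume "spanned k a" "spanned k b"
  then obtain v w where vw: "v \<in> span (mon k)" "a \<ominus> v \<in> P (Suc k)" "w \<in> span (mon k)" "b \<ominus> w \<in> P (Suc k)"
    "a \<in> P k" "b \<in> P k" unfolding spanned_def by blast
  have c: "v \<in> carrier A" "w \<in> carrier A" "a \<in> carrier A" "b \<in> carrier A"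
    using vw span_mon_P P_carrier by blast+
  have "(a \<oplus> b) \<ominus> (v \<oplus> w) = (a \<ominus> v) \<oplus> (b \<ominus> w)"
    using c by (simp add: a_minus_def M.minus_add M.a_ac)
  then have "(a \<oplus> b) \<ominus> (v \<oplus> w) \<in> P (Suc k)" using P_closed(2)[OF vw(2,4)] by simp
  then show ?thesis unfolding spanned_def
    using submodule_closed(1)[OF span_is_submodule[OF mon_carrier] vw(1,3)] P_closed(2)[OF vw(5,6)] by blast
qed

lemma spanned_P_Suc: "a \<in> P (Suc k) \<Longrightarrow> spanned k a"
  unfolding spanned_def using submodule_closed(3)[OF span_is_submodule[OF mon_carrier]] P_Suc_subset P_carrier[of a "Suc k"]
  by (intro conjI bexI[of _ \<zero>]) (auto simp: a_minus_def)

lemma spanned_finsum: "finite S \<Longrightarrow> (\<And>s. s \<in> S \<Longrightarrow> spanned k (f s)) \<Longrightarrow> spanned k (\<Oplus>s\<in>S. f s)"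
proof (induction rule: finite_induct)
  case (insert t S)
  have "f s \<in> carrier A" if "s \<in> insert t S" for s
    using insert(4)[OF that] P_carrier unfolding spanned_def by blast
  then have "(\<Oplus>s\<in>insert t S. f s) = f t \<oplus> (\<Oplus>s\<in>S. f s)"
    using insert by (intro M.finsum_insert) auto
  then show ?case using insert spanned_add by simp
qed (simp add: spanned_P_Suc P_closed(1))

lemma spanned_smult: "spanned k a \<Longrightarrow> spanned k (c \<odot> a)"
proof -
  assume "spanned k a"
  then obtain v where v: "v \<in> span (mon k)" "a \<ominus> v \<in> P (Suc k)" "a \<in> P k" unfolding spanned_def by blast
  have c: "v \<in> carrier A" "a \<in> carrier A" using v span_mon_P P_carrier by blast+
  have "c \<odot> a \<ominus> c \<odot> v \<in> P (Suc k)" using P_closed(5)[OF v(2), of c] c by (simp add: K_smult_diff)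
  then show ?thesis unfolding spanned_def
    using submodule_closed(2)[OF span_is_submodule[OF mon_carrier] v(1)] P_closed(5)[OF v(3)] by blast
qed

lemma spanned_mult_x: "spanned k a \<Longrightarrow> spanned (Suc k) (a \<otimes> x i)"
proof -
  assume "spanned k a"
  then obtain v where v: "v \<in> span (mon k)" "a \<ominus> v \<in> P (Suc k)" "a \<in> P k" unfolding spanned_def by blast
  have c: "v \<in> carrier A" "a \<in> carrier A" using v span_mon_P P_carrier by blast+
  \<comment> \<open>The elements that \<open>x i\<close> multiplies into the span of
    \<open>mon (Suc k)\<close> form a subspace; it contains \<open>mon k\<close> and hence its
    span.\<close>
  have "submodule class_ring {v \<in> carrier A. v \<otimes> x i \<in> span (mon (Suc k))} A"
    using submodule_closed[OF span_is_submodule[OF mon_carrier[of "Suc k"]]]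
    by (intro vectorspace_submodule) (auto simp: l_distr K_smult_mult)
  moreover have "mon k \<subseteq> {v \<in> carrier A. v \<otimes> x i \<in> span (mon (Suc k))}"
    using mon_carrier[of k] in_own_span[OF mon_carrier[of "Suc k"]] by auto
  ultimately have "v \<otimes> x i \<in> span (mon (Suc k))" using span_is_subset v(1) by blast
  moreover have "a \<otimes> x i \<ominus> v \<otimes> x i = (a \<ominus> v) \<otimes> x i"
    using c by (simp add: a_minus_def l_distr l_minus)
  moreover have "(a \<ominus> v) \<otimes> x i \<in> P (Suc (Suc k))" using P_mult[OF v(2) x_P[of i]] by simp
  moreover have "a \<otimes> x i \<in> P (Suc k)" using P_mult[OF v(3) x_P[of i]] by simp
  ultimately show ?thesis unfolding spanned_def by (intro conjI bexI[of _ "v \<otimes> x i"]) simp_all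
qed

text \<open>A product in \<open>P (Suc k)\<close> expands into terms
  \<open>a \<otimes> (x i \<otimes> g i)\<close>. Splitting \<open>g i\<close> into a scalar and an
  element of the ideal leaves a multiple of \<open>a \<otimes> x i\<close>, covered by induction,
  and a term in \<open>P (Suc (Suc k))\<close>.\<close>

lemma P_span: "a \<in> P k \<Longrightarrow> spanned k a"
proof (induction k arbitrary: a)
  case 0
  then obtain c where c: "a \<ominus> c \<odot> \<one> \<in> \<mm>" using residue by auto
  have "c \<odot> \<one> \<in> span (mon 0)"
    using submodule_closed(2)[OF span_is_submodule[OF mon_carrier[of 0]]] in_own_span[OF mon_carrier[of 0]] by simp
  then show ?case using 0 c unfolding spanned_def P_one by blast
next
  case (Suc k)
  have "a \<in> ideal_prod A (P k) \<mm>" using Suc.prems by (simp add: ideal_pow.simps(2))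
  then show ?case
  proof induction
    case (prod a y)
    obtain g where g: "\<And>i. g i \<in> carrier A" "y = (\<Oplus>i\<in>UNIV. x i \<otimes> g i)" using m_generated[OF prod(2)] by blast
    have ac: "a \<in> carrier A" using prod P_carrier by blast
    have "spanned (Suc k) (a \<otimes> (x i \<otimes> g i))" for i
    proof -
      obtain c where c: "g i \<ominus> c \<odot> \<one> \<in> \<mm>" using residue g(1) by blast
      have "spanned (Suc k) (c \<odot> (a \<otimes> x i))" using spanned_smult[OF spanned_mult_x[OF Suc.IH[OF prod(1)]]] .
      moreover have "a \<otimes> x i \<otimes> (g i \<ominus> c \<odot> \<one>) \<in> P (Suc (Suc k))"
        using P_mult[OF P_mult[OF prod(1) x_P], of "g i \<ominus> c \<odot> \<one>" "Suc 0"] c P_one by simp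
      then have "spanned (Suc k) (a \<otimes> x i \<otimes> (g i \<ominus> c \<odot> \<one>))" by (rule spanned_P_Suc)
      moreover have "a \<otimes> (x i \<otimes> g i) = c \<odot> (a \<otimes> x i) \<oplus> a \<otimes> x i \<otimes> (g i \<ominus> c \<odot> \<one>)"
      proof -
        have "c \<odot> (a \<otimes> x i) = a \<otimes> x i \<otimes> (c \<odot> \<one>)" using ac by (simp add: K_mult_smult)
        moreover have "c \<odot> \<one> \<oplus> (g i \<ominus> c \<odot> \<one>) = g i"
          using g(1)[of i] by (simp add: a_minus_def M.a_lcomm[of _ "g i"] M.r_neg)
        ultimately show ?thesis using ac g(1)[of i] by (simp add: r_distr[symmetric] m_assoc)
      qed
      ultimately show ?thesis using spanned_add by simp
    qed
    then have "spanned (Suc k) (\<Oplus>i\<in>UNIV. a \<otimes> (x i \<otimes> g i))" by (intro spanned_finsum) auto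
    moreover have "a \<otimes> y = (\<Oplus>i\<in>UNIV. a \<otimes> (x i \<otimes> g i))"
      unfolding g(2) using ac g(1) by (intro finsum_rdistr) auto
    ultimately show ?case by simp
  next
    case (sum a b)
    then show ?case using spanned_add by blast
  qed
qed

text \<open>The classes of the finitely many monomials of degree \<open>k\<close> generate, so the
  number given by \<open>hilbert_function\<close> is the size of an actual basis.\<close>

lemma graded_piece_fin_dim: "vectorspace.fin_dim class_ring (G k)"
proof -
  interpret V: vectorspace class_ring "G k" by (rule graded_piece_vectorspace)
  let ?q = "\<lambda>a. P (Suc k) +> a"
  let ?B = "?q ` mon k"
  have B: "?B \<subseteq> carrier (G k)" unfolding graded_piece_fields using mon_P by blast
  interpret B: submodule class_ring "V.span ?B" "G k" by (rule V.span_is_submodule[OF B])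
  have zero: "?q \<zero> = \<zero>\<^bsub>G k\<^esub>"
    using coset_eq_zero_iff[OF ideal_P[of "Suc k"], of \<zero>] P_closed(1) by (simp add: graded_piece_fields)
  have sub: "submodule class_ring {a \<in> carrier A. ?q a \<in> V.span ?B} A"
  proof (rule vectorspace_submodule)
    show "\<zero> \<in> {a \<in> carrier A. ?q a \<in> V.span ?B}" using zero B.zero_closed by simp
  next
    fix a b assume "a \<in> {a \<in> carrier A. ?q a \<in> V.span ?B}" "b \<in> {a \<in> carrier A. ?q a \<in> V.span ?B}"
    then show "a \<oplus> b \<in> {a \<in> carrier A. ?q a \<in> V.span ?B}"
      using B.m_closed[of "?q a" "?q b"] by (simp add: graded_piece_add)
  next
    fix c :: 'k and a assume "a \<in> {a \<in> carrier A. ?q a \<in> V.span ?B}"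
    then show "c \<odot> a \<in> {a \<in> carrier A. ?q a \<in> V.span ?B}"
      using B.smult_closed[of c "?q a"] by (simp add: graded_piece_smult)
  qed blast
  have mon: "mon k \<subseteq> {a \<in> carrier A. ?q a \<in> V.span ?B}"
    using mon_carrier V.in_own_span[OF B] by blast
  have *: "?q v \<in> V.span ?B" if v: "v \<in> span (mon k)" for v
    using subsetD[OF span_is_subset[OF mon sub] v] by simp
  have "carrier (G k) \<subseteq> V.span ?B"
  proof
    fix X assume "X \<in> carrier (G k)"
    then obtain a where a: "a \<in> P k" "X = ?q a" unfolding graded_piece_fields by blast
    obtain v where v: "v \<in> span (mon k)" "a \<ominus> v \<in> P (Suc k)" using P_span[OF a(1)] unfolding spanned_def by blast
    have "v \<in> carrier A" using v(1) span_mon_P P_carrier by blast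
    then have "?q a = ?q v" using v(2) coset_eq_iff[OF ideal_P[of "Suc k"] P_carrier[OF a(1)], of v] by simp
    then show "X \<in> V.span ?B" using * v(1) a(2) by simp
  qed
  then have "V.span ?B = carrier (G k)" using V.span_is_subset2[OF B] by blast
  then show ?thesis unfolding V.fin_dim_def
    using B finite_imageI[OF finite_mon] by (intro exI[of _ ?B] conjI)
qed

text \<open>Applying \<open>P_span\<close> degree by degree approximates an element by monomials of
  degree below \<open>N\<close> modulo \<open>P N\<close>, which is zero.\<close>

lemma fin_dim:
  assumes "P N = {\<zero>}"
  shows "vectorspace.fin_dim class_ring A"
proof -
  interpret V: vectorspace class_ring A by (rule algebra_vectorspace)
  let ?U = "\<lambda>k. \<Union>j<k. mon j"
  have U: "?U k \<subseteq> carrier A" for k using mon_carrier by blast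
  have "\<exists>v\<in>span (?U k). a \<ominus> v \<in> P k" if a: "a \<in> carrier A" for a k
  proof (induction k)
    case 0
    then show ?case using submodule_closed(3)[OF span_is_submodule[OF U[of 0]]] a
      by (intro bexI[of _ \<zero>]) auto
  next
    case (Suc k)
    then obtain v where v: "v \<in> span (?U k)" "a \<ominus> v \<in> P k" by blast
    obtain w where w: "w \<in> span (mon k)" "(a \<ominus> v) \<ominus> w \<in> P (Suc k)" using P_span[OF v(2)] unfolding spanned_def by blast
    have "?U k \<subseteq> span (?U (Suc k))" "mon k \<subseteq> span (?U (Suc k))"
      using in_own_span[OF U[of "Suc k"]] by (auto simp: lessThan_Suc)
    then have "span (?U k) \<subseteq> span (?U (Suc k))" "span (mon k) \<subseteq> span (?U (Suc k))"
      using span_is_subset[OF _ span_is_submodule[OF U[of "Suc k"]]] by blast+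
    then have "v \<oplus> w \<in> span (?U (Suc k))"
      using v(1) w(1) submodule_closed(1)[OF span_is_submodule[OF U[of "Suc k"]]] by blast
    moreover have "a \<ominus> (v \<oplus> w) \<in> P (Suc k)"
    proof -
      have "v \<in> carrier A" "w \<in> carrier A"
        using v(1) w(1) submodule_closed(4)[OF span_is_submodule] U mon_carrier by blast+
      then have "a \<ominus> (v \<oplus> w) = (a \<ominus> v) \<ominus> w" using a by (simp add: a_minus_def M.minus_add M.a_assoc)
      then show ?thesis using w(2) by simp
    qed
    ultimately show ?case by blast
  qed
  from this[of _ N] have "carrier A \<subseteq> span (?U N)"
  proof (intro subsetI)
    fix a assume a: "a \<in> carrier A"
    then obtain v where v: "v \<in> span (?U N)" "a \<ominus> v \<in> P N" using \<open>\<And>a. a \<in> carrier A \<Longrightarrow> \<exists>v\<in>span (?U N). a \<ominus> v \<in> P N\<close> by blast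
    then have "v \<in> carrier A" using submodule_closed(4)[OF span_is_submodule] U by blast
    then have "a = v" using a v(2) assms by simp
    then show "a \<in> span (?U N)" using v(1) by simp
  qed
  then have "span (?U N) = carrier A" using span_is_subset2[OF U] by blast
  then show ?thesis unfolding V.fin_dim_def using finite_mon U by (intro exI[of _ "?U N"]) auto
qed

text \<open>A basis of the graded piece is lifted to \<open>P i\<close>, and equations between
  cosets become congruences modulo \<open>P (Suc i)\<close>; from here on one computes with elements
  of the algebra.\<close>

lemma hilbert_basis:
  assumes "finite S" "hilbert_function class_ring A \<mm> i = card S"
  shows "\<exists>b. (\<forall>s\<in>S. b s \<in> P i) \<and>
    (\<forall>a\<in>P i. \<exists>c. a \<ominus> (\<Oplus>s\<in>S. c s \<odot> b s) \<in> P (Suc i)) \<and>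
    (\<forall>c. (\<Oplus>s\<in>S. c s \<odot> b s) \<in> P (Suc i) \<longrightarrow> (\<forall>s\<in>S. c s = 0))"
proof -
  interpret V: vectorspace class_ring "G i" by (rule graded_piece_vectorspace)
  let ?q = "\<lambda>a. P (Suc i) +> a"
  have "card S = V.dim" using assms(2) by (simp add: hilbert_function_def)
  from V.basis_family[OF graded_piece_fin_dim assms(1) this]
  obtain b' where b'0: "b' \<in> S \<rightarrow> carrier (G i)"
    "\<forall>v\<in>carrier (G i). \<exists>c\<in>S \<rightarrow> carrier class_ring. v = (\<Oplus>\<^bsub>G i\<^esub>s\<in>S. c s \<odot>\<^bsub>G i\<^esub> b' s)"
    "\<forall>c\<in>S \<rightarrow> carrier class_ring. (\<Oplus>\<^bsub>G i\<^esub>s\<in>S. c s \<odot>\<^bsub>G i\<^esub> b' s) = \<zero>\<^bsub>G i\<^esub> \<longrightarrow>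
      (\<forall>s\<in>S. c s = \<zero>\<^bsub>class_ring\<^esub>)"
    by (elim exE conjE)
  have b'_span: "\<exists>c. v = (\<Oplus>\<^bsub>G i\<^esub>s\<in>S. c s \<odot>\<^bsub>G i\<^esub> b' s)" if "v \<in> carrier (G i)" for v
    using bspec[OF b'0(2) that] by (elim bexE) (rule exI)
  have b'_indep: "\<forall>s\<in>S. c s = 0" if "(\<Oplus>\<^bsub>G i\<^esub>s\<in>S. c s \<odot>\<^bsub>G i\<^esub> b' s) = \<zero>\<^bsub>G i\<^esub>" for c
    using mp[OF bspec[OF b'0(3), of c] that] by simp
  have "\<forall>s\<in>S. \<exists>a. a \<in> P i \<and> b' s = ?q a"
    using b'0(1) unfolding graded_piece_fields by blast
  from bchoice[OF this] obtain b
    where b: "\<And>s. s \<in> S \<Longrightarrow> b s \<in> P i" "\<And>s. s \<in> S \<Longrightarrow> b' s = ?q (b s)" by blast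
  have bP: "c s \<odot> b s \<in> P i" if "s \<in> S" for c :: "_ \<Rightarrow> 'k" and s using b(1)[OF that] P_closed(5) by blast
  have sum: "(\<Oplus>\<^bsub>G i\<^esub>s\<in>S. c s \<odot>\<^bsub>G i\<^esub> b' s) = ?q (\<Oplus>s\<in>S. c s \<odot> b s)" "(\<Oplus>s\<in>S. c s \<odot> b s) \<in> P i" for c
  proof -
    have "(\<Oplus>\<^bsub>G i\<^esub>s\<in>S. c s \<odot>\<^bsub>G i\<^esub> b' s) = (\<Oplus>\<^bsub>G i\<^esub>s\<in>S. ?q (c s \<odot> b s))"
    proof (rule V.M.finsum_cong')
      show "(\<lambda>s. ?q (c s \<odot> b s)) \<in> S \<rightarrow> carrier (G i)"
        unfolding graded_piece_fields using bP by blast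
      show "c s \<odot>\<^bsub>G i\<^esub> b' s = ?q (c s \<odot> b s)" if "s \<in> S" for s
        unfolding b(2)[OF that] by (rule graded_piece_smult[OF P_carrier[OF b(1)[OF that]]])
    qed simp
    then show "(\<Oplus>\<^bsub>G i\<^esub>s\<in>S. c s \<odot>\<^bsub>G i\<^esub> b' s) = ?q (\<Oplus>s\<in>S. c s \<odot> b s)"
      "(\<Oplus>s\<in>S. c s \<odot> b s) \<in> P i"
      using graded_piece_finsum[OF assms(1), of "\<lambda>s. c s \<odot> b s" i] bP[of _ c] by simp_all
  qed
  have "\<exists>c. a \<ominus> (\<Oplus>s\<in>S. c s \<odot> b s) \<in> P (Suc i)" if a: "a \<in> P i" for a
  proof -
    have qa: "?q a \<in> carrier (G i)" unfolding graded_piece_fields using a by blast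
    obtain c where "?q a = ?q (\<Oplus>s\<in>S. c s \<odot> b s)" using b'_span[OF qa] unfolding sum(1) by (elim exE)
    then show ?thesis using coset_eq_iff[OF ideal_P P_carrier[OF a] P_carrier[OF sum(2)]] by blast
  qed
  moreover have "\<forall>s\<in>S. c s = 0" if "(\<Oplus>s\<in>S. c s \<odot> b s) \<in> P (Suc i)" for c
  proof (rule b'_indep)
    have "?q (\<Oplus>s\<in>S. c s \<odot> b s) = P (Suc i)"
      by (rule iffD2[OF coset_eq_zero_iff[OF ideal_P P_carrier[OF sum(2)]] that])
    then show "(\<Oplus>\<^bsub>G i\<^esub>s\<in>S. c s \<odot>\<^bsub>G i\<^esub> b' s) = \<zero>\<^bsub>G i\<^esub>"
      using sum(1)[of c] by (simp only: graded_piece_fields(2))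
  qed
  ultimately show ?thesis using b(1) by (intro exI[of _ b]) simp
qed

text \<open>The empty family is a basis of the graded piece, so every element of \<open>P i\<close>
  is congruent to the empty sum.\<close>

lemma hilbert_zero:
  assumes "hilbert_function class_ring A \<mm> i = 0"
  shows "P (Suc i) = P i"
proof -
  from hilbert_basis[of "{} :: nat set" i] assms
  have z: "\<forall>a\<in>P i. a \<ominus> \<zero> \<in> P (Suc i)" by simp
  have "P i \<subseteq> P (Suc i)"
  proof
    fix a assume a: "a \<in> P i"
    then show "a \<in> P (Suc i)" using bspec[OF z a] P_carrier[OF a] by (simp add: a_minus_def)
  qed
  then show ?thesis using P_Suc_subset by blast
qed

lemma socle_submodule: "submodule class_ring {x \<in> carrier A. \<forall>y\<in>\<mm>. x \<otimes> y = \<zero>} A"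
  using ideal.Icarr[OF ideal_m] by (intro vectorspace_submodule) (auto simp: l_distr K_smult_mult)

end

section \<open>The pairing of a short Gorenstein algebra\<close>

text \<open>The \<open>b i\<close> lift a basis of degree 2 and share their index type with the
  generators \<open>x i\<close>, so that the matrix of the pairing is square. The element
  \<open>s\<close> spans the third power, and \<open>socle_P3\<close> is the Gorenstein condition in
  the form in which it is used.\<close>

locale short_gorenstein = generated_adic_algebra A \<mm> x
  for A :: "('k::field, 'a) module" (structure) and \<mm> and x :: "'n::finite \<Rightarrow> 'a" +
  fixes b :: "'n \<Rightarrow> 'a" and s :: 'a
  assumes char: "(2 :: 'k) \<noteq> 0"
    and P4: "P 4 = {\<zero>}"
    and one_notin: "\<one> \<notin> \<mm>"
    and b_P2: "b i \<in> P 2"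
    and b_span: "a \<in> P 2 \<Longrightarrow> \<exists>c. a \<ominus> (\<Oplus>j\<in>UNIV. c j \<odot> b j) \<in> P 3"
    and b_indep: "(\<Oplus>j\<in>UNIV. c j \<odot> b j) \<in> P 3 \<Longrightarrow> c j = 0"
    and s_P3: "s \<in> P 3"
    and s_span: "a \<in> P 3 \<Longrightarrow> \<exists>d. a = d \<odot> s"
    and s_nonzero: "s \<noteq> \<zero>"
    and socle_P3: "a \<in> carrier A \<Longrightarrow> (\<And>y. y \<in> \<mm> \<Longrightarrow> a \<otimes> y = \<zero>) \<Longrightarrow> a \<in> P 3"
begin

definition lb :: "('n \<Rightarrow> 'k) \<Rightarrow> 'a" where "lb c = (\<Oplus>j\<in>UNIV. c j \<odot> b j)"

lemma P32: "P 3 \<subseteq> P 2" by (rule P_antimono) simp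

lemma s_carrier [simp]: "s \<in> carrier A" using s_P3 P_carrier by blast

lemma b_carrier [simp]: "b j \<in> carrier A" using b_P2 P_carrier by blast

lemma lb_P2: "lb c \<in> P 2"
  unfolding lb_def by (rule P_finsum) (auto intro: P_closed(5) b_P2)

lemma lb_carrier [simp]: "lb c \<in> carrier A"
  using lb_P2 P_carrier by blast

lemma lb_add: "lb (\<lambda>j. c j + d j) = lb c \<oplus> lb d"
  unfolding lb_def by (simp add: K_smult_l_distr M.finsum_addf)

lemma lb_smult: "lb (\<lambda>j. k * c j) = k \<odot> lb c"
  unfolding lb_def using finsum_smult_ldistr[of UNIV k "\<lambda>j. c j \<odot> b j"]
  by (simp add: K_smult_assoc)

lemma smult_eq_zero: "y \<in> carrier A \<Longrightarrow> k \<odot> y = \<zero> \<Longrightarrow> y \<noteq> \<zero> \<Longrightarrow> k = 0"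
proof (rule ccontr)
  assume y: "y \<in> carrier A" "k \<odot> y = \<zero>" "y \<noteq> \<zero>" and k: "k \<noteq> 0"
  have "(inverse k * k) \<odot> y = \<zero>" by (simp only: K_smult_assoc[OF y(1)] y(2) K_smult_r_null)
  then show False using y k by simp
qed

lemma P2_cases: "a \<in> P 2 \<Longrightarrow> \<exists>c d. a = lb c \<oplus> d \<odot> s"
proof -
  assume a: "a \<in> P 2"
  obtain c where "a \<ominus> lb c \<in> P 3" using b_span[OF a] unfolding lb_def by blast
  then obtain d where d: "a \<ominus> lb c = d \<odot> s" using s_span by blast
  have "lb c \<oplus> (a \<ominus> lb c) = a"
    using P_carrier[OF a] by (simp add: a_minus_def M.a_lcomm[of _ a] M.r_neg)
  then show ?thesis using d by metis
qed

lemma P2_coords_unique: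
  assumes "lb c \<oplus> d \<odot> s = lb c' \<oplus> d' \<odot> s"
  shows "d = d'"
proof -
  have e: "lb (\<lambda>j. c j + (- 1) * c' j) \<oplus> (d - d') \<odot> s = \<zero>"
  proof -
    have "lb (\<lambda>j. c j + (- 1) * c' j) = lb c \<ominus> lb c'"
      unfolding lb_add lb_smult by (simp add: K_smult_l_minus a_minus_def)
    moreover have "(d - d') \<odot> s = d \<odot> s \<ominus> d' \<odot> s"
      using K_smult_l_distr[of s d "- d'"] by (simp add: K_smult_l_minus a_minus_def)
    ultimately have "lb (\<lambda>j. c j + (- 1) * c' j) \<oplus> (d - d') \<odot> s = (lb c \<oplus> d \<odot> s) \<ominus> (lb c' \<oplus> d' \<odot> s)"
      by (simp add: a_minus_def M.minus_add M.a_ac)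
    then show ?thesis unfolding assms by (simp add: a_minus_def M.r_neg)
  qed
  have "lb (\<lambda>j. c j + (- 1) * c' j) = \<ominus> ((d - d') \<odot> s)"
    using e by (intro M.minus_equality[symmetric]) auto
  then have L: "lb (\<lambda>j. c j + (- 1) * c' j) \<in> P 3" using P_closed(3)[OF P_closed(5)[OF s_P3]] by simp
  \<comment> \<open>The zero coefficients are written as multiples of \<open>c' j\<close> so that
    \<open>lb_smult\<close> can extract the scalar 0.\<close>
  have "c j + (- 1) * c' j = 0 * c' j" for j
    using b_indep[OF L[unfolded lb_def], of j] by simp
  then have "lb (\<lambda>j. c j + (- 1) * c' j) = \<zero>" by (simp only: lb_smult) simp
  then have "(d - d') \<odot> s = \<zero>" using e by simp
  then show ?thesis using smult_eq_zero[of s "d - d'"] s_nonzero by simp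
qed

text \<open>On \<open>P 2\<close> this is the coordinate at \<open>s\<close>: the linear form with
  value 1 at \<open>s\<close> that vanishes on the complement of \<open>P 3\<close> spanned by the
  chosen \<open>b j\<close>. Outside \<open>P 2\<close> no decomposition exists and the value is
  unspecified.\<close>

definition \<phi> :: "'a \<Rightarrow> 'k" where "\<phi> a = (THE d. \<exists>c. a = lb c \<oplus> d \<odot> s)"

lemma \<phi>_eq: "\<phi> (lb c \<oplus> d \<odot> s) = d"
  unfolding \<phi>_def by (rule the_equality) (auto dest: P2_coords_unique)

lemma \<phi>_add:
  assumes "y \<in> P 2" "z \<in> P 2"
  shows "\<phi> (y \<oplus> z) = \<phi> y + \<phi> z"
proof -
  obtain c d c' d' where e: "y = lb c \<oplus> d \<odot> s" "z = lb c' \<oplus> d' \<odot> s" using P2_cases assms by metis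
  have "y \<oplus> z = lb (\<lambda>j. c j + c' j) \<oplus> (d + d') \<odot> s"
    unfolding e lb_add by (simp add: K_smult_l_distr M.a_ac)
  then show ?thesis by (simp only: \<phi>_eq) (simp add: e \<phi>_eq)
qed

lemma \<phi>_smult:
  assumes "y \<in> P 2"
  shows "\<phi> (k \<odot> y) = k * \<phi> y"
proof -
  obtain c d where e: "y = lb c \<oplus> d \<odot> s" using P2_cases assms by metis
  have "k \<odot> y = lb (\<lambda>j. k * c j) \<oplus> (k * d) \<odot> s"
    unfolding e lb_smult by (simp add: K_smult_r_distr K_smult_assoc)
  then show ?thesis by (simp only: \<phi>_eq) (simp add: e \<phi>_eq)
qed

lemma lb_zero: "lb (\<lambda>j. 0) = \<zero>"
  using lb_smult[of 0 "\<lambda>j. 0"] by simp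

lemma \<phi>_s: "\<phi> (d \<odot> s) = d"
  using \<phi>_eq[of "\<lambda>j. 0" d] by (simp add: lb_zero)

lemma \<phi>_zero [simp]: "\<phi> \<zero> = 0"
  using \<phi>_s[of 0] by simp

lemma \<phi>_P3: "y \<in> P 3 \<Longrightarrow> \<phi> y = 0 \<Longrightarrow> y = \<zero>"
  using s_span[of y] \<phi>_s by auto

lemma \<phi>_finsum: "finite S \<Longrightarrow> (\<And>i. i \<in> S \<Longrightarrow> f i \<in> P 2) \<Longrightarrow> \<phi> (\<Oplus>i\<in>S. f i) = (\<Sum>i\<in>S. \<phi> (f i))"
proof (induction rule: finite_induct)
  case (insert t S)
  have "f i \<in> carrier A" if "i \<in> insert t S" for i using insert(4)[OF that] by (rule P_carrier)
  then have "(\<Oplus>i\<in>insert t S. f i) = f t \<oplus> (\<Oplus>i\<in>S. f i)"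
    using insert by (intro M.finsum_insert) auto
  moreover have "(\<Oplus>i\<in>S. f i) \<in> P 2" using insert by (intro P_finsum) auto
  ultimately show ?case using insert by (simp add: \<phi>_add)
qed simp

lemma x_mult_P2: "y \<in> P 2 \<Longrightarrow> x i \<otimes> y \<in> P 3"
  using P_mult[OF x_P[of i], of y 2] by (simp add: numeral_3_eq_3)

lemma P2_mult_P2: "y \<in> P 2 \<Longrightarrow> z \<in> P 2 \<Longrightarrow> y \<otimes> z = \<zero>"
  using P_mult[of y 2 z 2] P4 by simp

text \<open>The pairing $\mathfrak m/\mathfrak m^2 \times \mathfrak m^2/\mathfrak m^3 \to K$ is perfect: its right
  kernel is the socle modulo $\mathfrak m^3$, and both sides have dimension $n$.\<close>

lemma pairing_surjective: "\<exists>y\<in>P 2. \<forall>i. \<phi> (x i \<otimes> y) = f i"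
proof -
  \<comment> \<open>\<open>T\<close> is the matrix of the pairing in the coordinates of
    \<open>b\<close> and \<open>x\<close>. As an endomorphism of a finite-dimensional space it is
    surjective once it is injective.\<close>
  define T :: "'k^'n \<Rightarrow> 'k^'n" where "T c = (\<chi> i. \<phi> (x i \<otimes> lb (vec_nth c)))" for c
  have xlb: "x i \<otimes> lb c \<in> P 2" for i c by (rule subsetD[OF P32 x_mult_P2[OF lb_P2]])
  have lin: "Vector_Spaces.linear (*s) (*s) T"
  proof unfold_locales
    fix c d :: "'k^'n"
    have "x i \<otimes> lb (vec_nth (c + d)) = x i \<otimes> lb (vec_nth c) \<oplus> x i \<otimes> lb (vec_nth d)" for i
    proof -
      have "vec_nth (c + d) = (\<lambda>j. vec_nth c j + vec_nth d j)" by (simp add: fun_eq_iff)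
      then show ?thesis by (simp add: lb_add r_distr)
    qed
    then have "\<phi> (x i \<otimes> lb (vec_nth (c + d))) = \<phi> (x i \<otimes> lb (vec_nth c)) + \<phi> (x i \<otimes> lb (vec_nth d))" for i
      using \<phi>_add[OF xlb xlb] by simp
    then show "T (c + d) = T c + T d" unfolding T_def by (simp add: Finite_Cartesian_Product.vec_eq_iff)
  next
    fix k and c :: "'k^'n"
    have "x i \<otimes> lb (vec_nth (k *s c)) = k \<odot> (x i \<otimes> lb (vec_nth c))" for i
    proof -
      have "vec_nth (k *s c) = (\<lambda>j. k * vec_nth c j)" by (simp add: fun_eq_iff)
      then show ?thesis by (simp add: lb_smult K_mult_smult)
    qed
    then have "\<phi> (x i \<otimes> lb (vec_nth (k *s c))) = k * \<phi> (x i \<otimes> lb (vec_nth c))" for i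
      using \<phi>_smult[OF xlb] by simp
    then show "T (k *s c) = k *s T c" unfolding T_def by (simp add: Finite_Cartesian_Product.vec_eq_iff)
  qed
  \<comment> \<open>Each product with \<open>x i\<close> lies in \<open>P 3\<close>, where \<phi> is
    injective, so these products vanish. Then \<open>lb c\<close> annihilates the whole ideal, lies
    in \<open>P 3\<close> by the Gorenstein condition, and has zero coordinates by
    \<open>b_indep\<close>.\<close>
  have T0: "c = 0" if c: "T c = 0" for c :: "'k^'n"
  proof -
    have xz: "x i \<otimes> lb (vec_nth c) = \<zero>" for i
    proof (rule \<phi>_P3[OF x_mult_P2[OF lb_P2]])
      have "vec_nth (T c) i = 0" using c by simp
      then show "\<phi> (x i \<otimes> lb (vec_nth c)) = 0" by (simp add: T_def)
    qed
    have L: "lb (vec_nth c) \<in> P 3"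
    proof (rule socle_P3[OF lb_carrier])
      fix y assume "y \<in> \<mm>"
      then obtain g where g: "\<And>i. g i \<in> carrier A" "y = (\<Oplus>i\<in>UNIV. x i \<otimes> g i)" using m_generated by blast
      have "lb (vec_nth c) \<otimes> y = (\<Oplus>i\<in>UNIV. lb (vec_nth c) \<otimes> (x i \<otimes> g i))"
        unfolding g(2) using g(1) by (intro finsum_rdistr) auto
      also have "\<dots> = (\<Oplus>i\<in>(UNIV :: 'n set). \<zero>)"
      proof (rule M.finsum_cong')
        fix i
        have "lb (vec_nth c) \<otimes> (x i \<otimes> g i) = (x i \<otimes> lb (vec_nth c)) \<otimes> g i"
          using g(1) by (simp add: m_ac)
        then show "lb (vec_nth c) \<otimes> (x i \<otimes> g i) = \<zero>" using xz g(1) by simp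
      qed auto
      finally show "lb (vec_nth c) \<otimes> y = \<zero>" by (simp add: M.finsum_zero)
    qed
    show "c = 0"
      unfolding Finite_Cartesian_Product.vec_eq_iff zero_index using b_indep[OF L[unfolded lb_def]] by blast
  qed
  interpret T: Vector_Spaces.linear "(*s)" "(*s)" T by (rule lin)
  have "inj T"
  proof (rule injI)
    fix c d assume "T c = T d"
    then have "T (c - d) = 0" by (simp add: T.diff)
    then show "c = d" using T0[of "c - d"] by simp
  qed
  then have "surj T" using vec.linear_injective_imp_surjective[OF lin] by blast
  then obtain c where c: "(\<chi> i. f i) = T c" by (metis surjD)
  have "\<phi> (x i \<otimes> lb (vec_nth c)) = f i" for i
    using arg_cong[OF c, of "\<lambda>v. vec_nth v i"] by (simp add: T_def)
  then show ?thesis using lb_P2 by blast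
qed

text \<open>The lifts $x_i' = x_i + d_i$ are corrected by $d_i \in \mathfrak m^2$ so that the products
  $x_i'x_j'$ lie in the complement $\ker\varphi$ of $\mathfrak m^3$ in $\mathfrak m^2$.\<close>

lemma corrected_lifts:
  "\<exists>x'. (\<forall>i. x' i \<ominus> x i \<in> P 2) \<and> (\<forall>i. x' i \<in> P (Suc 0)) \<and> (\<forall>i j. \<phi> (x' i \<otimes> x' j) = 0)"
proof -
  have "\<exists>y\<in>P 2. \<forall>j. \<phi> (x j \<otimes> y) = - \<phi> (x j \<otimes> x i) / 2" for i by (rule pairing_surjective)
  then obtain d where d: "\<And>i. d i \<in> P 2" "\<And>i j. \<phi> (x j \<otimes> d i) = - \<phi> (x j \<otimes> x i) / 2" by metis
  note dc [simp] = P_carrier[OF d(1)]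
  have "\<phi> ((x i \<oplus> d i) \<otimes> (x j \<oplus> d j)) = 0" for i j
  proof -
    have xx: "x i \<otimes> x j \<in> P 2" for i j using P_mult[OF x_P[of i] x_P[of j]] by (simp add: numeral_2_eq_2)
    have xd: "x i \<otimes> d j \<in> P 2" for i j using x_mult_P2[OF d(1)] P32 by blast
    have "(x i \<oplus> d i) \<otimes> (x j \<oplus> d j) = x i \<otimes> x j \<oplus> (x i \<otimes> d j \<oplus> x j \<otimes> d i)"
      using P2_mult_P2[OF d(1)[of i] d(1)[of j]] m_comm[of "d i" "x j"] by (simp add: l_distr r_distr M.a_ac)
    then have "\<phi> ((x i \<oplus> d i) \<otimes> (x j \<oplus> d j)) = \<phi> (x i \<otimes> x j) + (- \<phi> (x i \<otimes> x j) / 2 + - \<phi> (x j \<otimes> x i) / 2)"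
      using \<phi>_add[OF xx P_closed(2)[OF xd xd]] \<phi>_add[OF xd xd] d(2) by simp
    also have "\<dots> = 0" using char m_comm[of "x i" "x j"] by (simp add: field_simps)
    finally show ?thesis .
  qed
  moreover have "(x i \<oplus> d i) \<ominus> x i \<in> P 2" for i
  proof -
    have "(x i \<oplus> d i) \<ominus> x i = d i" by (simp add: a_minus_def M.a_ac M.r_neg)
    then show ?thesis using d(1) by simp
  qed
  moreover have "x i \<oplus> d i \<in> P (Suc 0)" for i
    using P_closed(2)[OF x_P[of i] subsetD[OF P_antimono d(1)[of i]]] by simp
  ultimately show ?thesis by (intro exI[of _ "\<lambda>i. x i \<oplus> d i"]) blast
qed


lemma canonically_graded: "canonically_graded class_ring A \<mm>"
proof -
  obtain x' where xd: "\<And>i. x' i \<ominus> x i \<in> P 2" and x1: "\<And>i. x' i \<in> P (Suc 0)"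
    and xx: "\<And>i j. \<phi> (x' i \<otimes> x' j) = 0"
    using corrected_lifts by auto
  have xc [simp]: "x' i \<in> carrier A" for i using x1 by (rule P_carrier)
  define lx where "lx u = (\<Oplus>i\<in>UNIV. u i \<odot> x' i)" for u
  have lx_P: "lx u \<in> P (Suc 0)" for u
    unfolding lx_def by (rule P_finsum) (auto intro: P_closed(5) x1)
  have lx_carrier [simp]: "lx u \<in> carrier A" for u using lx_P by (rule P_carrier)
  have lx_add: "lx u \<oplus> lx v = lx (\<lambda>i. u i + v i)" for u v
    unfolding lx_def by (simp add: K_smult_l_distr M.finsum_addf)
  have lx_smult: "k \<odot> lx u = lx (\<lambda>i. k * u i)" for k u
    unfolding lx_def using finsum_smult_ldistr[of UNIV k "\<lambda>j. u j \<odot> x' j"]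
    by (simp add: K_smult_assoc)
  have xz: "x' i \<otimes> z \<in> P 2" if "z \<in> P (Suc 0)" for i z
    using P_mult[OF x1[of i] that] by (simp add: numeral_2_eq_2)
  have \<phi>_lx: "\<phi> (lx u \<otimes> z) = (\<Sum>i\<in>UNIV. u i * \<phi> (x' i \<otimes> z))" if z: "z \<in> P (Suc 0)" for u z
  proof -
    note zc = P_carrier[OF z]
    have "lx u \<otimes> z = (\<Oplus>i\<in>UNIV. (u i \<odot> x' i) \<otimes> z)"
      unfolding lx_def using zc by (intro finsum_ldistr) auto
    also have "\<dots> = (\<Oplus>i\<in>UNIV. u i \<odot> (x' i \<otimes> z))"
      using zc by (intro M.finsum_cong') (auto simp: K_smult_mult)
    finally have "\<phi> (lx u \<otimes> z) = (\<Sum>i\<in>UNIV. \<phi> (u i \<odot> (x' i \<otimes> z)))"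
      using \<phi>_finsum[of UNIV "\<lambda>i. u i \<odot> (x' i \<otimes> z)"] P_closed(5)[OF xz[OF z]] by simp
    then show ?thesis by (simp add: \<phi>_smult[OF xz[OF z]])
  qed
  \<comment> \<open>The corrections are invisible in products with \<open>P 2\<close>, so the
    corrected lifts define the same pairing.\<close>
  have xy: "x' i \<otimes> y = x i \<otimes> y" if y: "y \<in> P 2" for i y
  proof -
    have "(x' i \<ominus> x i) \<otimes> y = \<zero>" using P2_mult_P2[OF xd y] .
    then have "x' i \<otimes> y \<ominus> x i \<otimes> y = \<zero>"
      using P_carrier[OF y] by (simp add: a_minus_def l_distr l_minus)
    then show ?thesis using P_carrier[OF y] by simp
  qed
  have P21: "P 2 \<subseteq> P (Suc 0)" by (rule P_antimono) simp
  \<comment> \<open>Multiplying by an element \<open>y\<close> dual to \<open>x j\<close> and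
    applying \<phi> reads off \<open>u j\<close>. If \<open>lx u\<close> lies in \<open>P 2\<close>,
    this product lies in \<open>P 4\<close> and vanishes.\<close>
  have lx_indep: "lx u = \<zero>" if u: "lx u \<in> P 2" for u
  proof -
    have "u j = 0" for j
    proof -
      obtain y where y: "y \<in> P 2" "\<And>i. \<phi> (x i \<otimes> y) = (if i = j then 1 else 0)"
        using pairing_surjective[of "\<lambda>i. if i = j then 1 else 0"] by blast
      have "0 = \<phi> (lx u \<otimes> y)" using P2_mult_P2[OF u y(1)] by simp
      also have "\<dots> = (\<Sum>i\<in>UNIV. u i * (if i = j then 1 else 0))"
        using \<phi>_lx[OF subsetD[OF P21 y(1)]] by (simp add: xy[OF y(1)] y(2))
      also have "\<dots> = (\<Sum>i\<in>UNIV. if i = j then u i else 0)"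
        by (rule sum.cong) auto
      also have "\<dots> = u j" by (simp add: sum.delta)
      finally show ?thesis by (rule sym)
    qed
    then have "u = (\<lambda>i. 0 * u i)" by auto
    then have "lx u = 0 \<odot> lx u" unfolding lx_smult by (rule arg_cong)
    then show ?thesis by simp
  qed
  have lx_span: "\<exists>u. a \<ominus> lx u \<in> P 2" if a: "a \<in> P (Suc 0)" for a
  proof -
    obtain g where g: "\<And>i. g i \<in> carrier A" "a = (\<Oplus>i\<in>UNIV. x i \<otimes> g i)"
      using m_generated[of a] a P_one by blast
    have "\<forall>i. \<exists>c. g i \<ominus> c \<odot> \<one> \<in> P (Suc 0)" using residue[OF g(1)] P_one by simp
    then obtain c where c: "\<And>i. g i \<ominus> c i \<odot> \<one> \<in> P (Suc 0)" by metis
    \<comment> \<open>\<open>t i\<close> is \<open>x i \<otimes> g i\<close> without its new linear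
      part \<open>c i \<odot> x' i\<close>: it combines the nonscalar part of \<open>g i\<close>
      with the change from \<open>x i\<close> to \<open>x' i\<close>, and both contributions lie in
      \<open>P 2\<close>.\<close>
    define t where "t i = x i \<otimes> (g i \<ominus> c i \<odot> \<one>) \<ominus> c i \<odot> (x' i \<ominus> x i)" for i
    have t: "t i \<in> P 2" for i
      unfolding t_def using P_mult[OF x_P[of i] c[of i]]
      by (intro P_closed(4) P_closed(5) xd) (simp add: numeral_2_eq_2)
    note tc [simp] = P_carrier[OF t]
    have cancel: "(u \<ominus> v) \<ominus> (w \<ominus> v) = u \<ominus> w"
      if "u \<in> carrier A" "v \<in> carrier A" "w \<in> carrier A" for u v w
      using that by algebra
    have "t i \<oplus> c i \<odot> x' i = x i \<otimes> g i" for i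
    proof -
      have "t i = (x i \<otimes> g i \<ominus> c i \<odot> x i) \<ominus> (c i \<odot> x' i \<ominus> c i \<odot> x i)"
        unfolding t_def using g(1)[of i] by (simp add: a_minus_def r_distr r_minus K_mult_smult K_smult_diff[unfolded a_minus_def])
      also have "\<dots> = x i \<otimes> g i \<ominus> c i \<odot> x' i"
        using g(1)[of i] by (intro cancel) auto
      finally show ?thesis using g(1)[of i] by (simp add: a_minus_def M.a_assoc M.l_neg)
    qed
    then have "a = (\<Oplus>i\<in>UNIV. t i) \<oplus> lx c"
      unfolding g(2) lx_def by (subst M.finsum_addf[symmetric]) auto
    then have "a \<ominus> lx c = (\<Oplus>i\<in>UNIV. t i)"
      by (simp add: a_minus_def M.a_assoc M.r_neg M.finsum_closed)
    moreover have "(\<Oplus>i\<in>UNIV. t i) \<in> P 2" using t by (intro P_finsum) auto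
    ultimately show ?thesis by (intro exI[of _ c]) simp
  qed
  \<comment> \<open>From degree 3 on the piece is the full power: this gives the span of
    \<open>s\<close> in degree 3 and zero above, without further cases.\<close>
  define C :: "nat \<Rightarrow> 'a set" where
    "C i = (if i = 0 then range (\<lambda>c. c \<odot> \<one>) else if i = 1 then range lx
      else if i = 2 then {y \<in> P 2. \<phi> y = 0} else P i)" for i
  have C: "C 0 = range (\<lambda>c. c \<odot> \<one>)" "C (Suc 0) = range lx" "C 2 = {y \<in> P 2. \<phi> y = 0}"
    "\<And>i. 3 \<le> i \<Longrightarrow> C i = P i"
    by (auto simp: C_def)
  have index_cases: thesis if "i = 0 \<Longrightarrow> thesis" "i = Suc 0 \<Longrightarrow> thesis" "i = 2 \<Longrightarrow> thesis" "3 \<le> i \<Longrightarrow> thesis"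
    for i :: nat and thesis
    using that by linarith
  have C_sub: "submodule class_ring (C i) A" for i
  proof (rule index_cases[of i])
    assume i: "i = 0"
    have "\<zero> \<in> range (\<lambda>c. c \<odot> \<one>)" by (rule image_eqI[of _ _ 0]) auto
    then show ?thesis unfolding i C
      by (intro vectorspace_submodule) (auto simp: K_smult_l_distr[symmetric] K_smult_assoc[symmetric])
  next
    assume i: "i = Suc 0"
    have "\<zero> = lx (\<lambda>i. 0)" using lx_smult[of 0 "\<lambda>i. 0"] by simp
    then have "\<zero> \<in> range lx" by (rule image_eqI[of _ lx "\<lambda>i. 0"]) simp
    then show ?thesis unfolding i C
      by (intro vectorspace_submodule) (auto simp: lx_add lx_smult)
  next
    assume i: "i = 2"
    show ?thesis unfolding i C
      by (rule vectorspace_submodule) (auto simp: P_carrier P_closed \<phi>_add \<phi>_smult)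
  next
    assume i: "3 \<le> i"
    show ?thesis unfolding C(4)[OF i] by (rule ideal_submodule[OF ideal_P])
  qed
  have C_P: "C i \<subseteq> P i" for i
    by (rule index_cases[of i]) (use lx_P in \<open>auto simp: C\<close>)
  have C_mult: "y \<otimes> z \<in> C (i + j)" if yz: "y \<in> C i" "z \<in> C j" for i j y z
  proof -
    have c: "y \<in> carrier A" "z \<in> carrier A" using yz C_P P_carrier by blast+
    \<comment> \<open>A scalar factor stays within the piece of the other factor, and a product of
      total degree at least 3 lies in a power that is itself the piece. The corrected lifts matter
      only for two factors of degree 1.\<close>
    consider "i = 0" | "j = 0" | "i = Suc 0" "j = Suc 0" | "3 \<le> i + j" by linarith
    then show ?thesis
    proof cases
      case 1
      then obtain k where "y = k \<odot> \<one>" using yz(1) C(1) by auto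
      then show ?thesis using 1 c yz(2) submodule_closed(2)[OF C_sub] by (simp add: K_smult_mult)
    next
      case 2
      then obtain k where "z = k \<odot> \<one>" using yz(2) C(1) by auto
      then show ?thesis using 2 c yz(1) submodule_closed(2)[OF C_sub] by (simp add: K_mult_smult)
    next
      case 3
      then obtain u v where uv: "y = lx u" "z = lx v" using yz C(2) by auto
      \<comment> \<open>\<open>\<phi>_lx\<close> expands the left factor only; commutativity lets it
        be used once for each factor.\<close>
      have "\<phi> (x' i \<otimes> lx v) = 0" for i
      proof -
        have "\<phi> (lx v \<otimes> x' i) = 0" by (simp add: \<phi>_lx[OF x1] xx)
        then show ?thesis by (simp add: m_comm)
      qed
      then have "\<phi> (y \<otimes> z) = 0" unfolding uv by (simp add: \<phi>_lx[OF lx_P])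
      moreover have "y \<otimes> z \<in> P 2" using P_mult[OF lx_P lx_P] uv by (simp add: numeral_2_eq_2)
      ultimately show ?thesis using 3 C(3) by (simp add: numeral_2_eq_2)
    next
      case 4
      then show ?thesis using P_mult[of y i z j] yz C_P C(4)[OF 4] by blast
    qed
  qed
  have C_span: "\<exists>c\<in>C i. a \<ominus> c \<in> P (Suc i)" if a: "a \<in> P i" for i a
  proof (rule index_cases[of i])
    assume i: "i = 0"
    then show ?thesis using residue[of a] a P_one C(1) by auto
  next
    assume i: "i = Suc 0"
    then show ?thesis using lx_span[of a] a C(2) by (auto simp: numeral_2_eq_2)
  next
    assume i: "i = 2"
    \<comment> \<open>Removing the component along \<open>s\<close> lands in the kernel of \<phi>,
      and the removed part lies in \<open>P 3\<close>.\<close>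
    have "a \<ominus> \<phi> a \<odot> s \<in> C i"
    proof -
      have a2: "a \<in> P 2" using a i by simp
      have "a \<ominus> \<phi> a \<odot> s = a \<oplus> (- \<phi> a) \<odot> s" by (simp add: a_minus_def K_smult_l_minus)
      moreover have "(- \<phi> a) \<odot> s \<in> P 2" using s_P3 P32 P_closed(5) by blast
      ultimately show ?thesis unfolding i C(3)
        using a2 P_closed(2) by (simp add: \<phi>_add \<phi>_s)
    qed
    moreover have "a \<ominus> (a \<ominus> \<phi> a \<odot> s) \<in> P (Suc i)"
    proof -
      have "a \<ominus> (a \<ominus> \<phi> a \<odot> s) = \<phi> a \<odot> s"
        using P_carrier[OF a] by (simp add: a_minus_def M.minus_add M.r_neg2)
      then show ?thesis using P_closed(5)[OF s_P3] i by (simp add: numeral_3_eq_3 numeral_2_eq_2)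
    qed
    ultimately show ?thesis by blast
  next
    assume i: "3 \<le> i"
    then show ?thesis using a P_carrier[OF a] P_closed(1)
      by (intro bexI[of _ a]) (auto simp: C a_minus_def M.r_neg)
  qed
  have C_indep: "c = \<zero>" if c: "c \<in> C i" "c \<in> P (Suc i)" for i c
  proof (rule index_cases[of i])
    assume i: "i = 0"
    then obtain k where k: "c = k \<odot> \<one>" using c(1) C(1) by auto
    have "k = 0"
    proof (rule ccontr)
      assume "k \<noteq> 0"
      then have "inverse k \<odot> c = \<one>" unfolding k by (simp add: K_smult_assoc[symmetric])
      then show False using P_closed(5)[of c "Suc 0" "inverse k"] c(2) i P_one one_notin by simp
    qed
    then show ?thesis using k by simp
  next
    assume i: "i = Suc 0"
    then show ?thesis using c C(2) lx_indep by (auto simp: numeral_2_eq_2)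
  next
    assume i: "i = 2"
    then show ?thesis using c C(3) \<phi>_P3 by (simp add: numeral_3_eq_3 numeral_2_eq_2)
  next
    assume "3 \<le> i"
    then have "P (Suc i) \<subseteq> P 4" by (intro P_antimono) simp
    then show ?thesis using c(2) P4 by auto
  qed
  show ?thesis
  proof (rule canonically_gradedI[of C 4])
    show "\<one> \<in> C 0" unfolding C by (intro image_eqI[of _ _ 1]) auto
  qed (fact C_sub C_mult C_P C_span C_indep P4)+
qed

end

section \<open>From dimensions and the socle to the short Gorenstein situation\<close>

context generated_adic_algebra
begin

lemma finsum_singleton_unit: "f () \<in> carrier A \<Longrightarrow> (\<Oplus>s\<in>{()}. f s) = f ()"
  by (subst M.finsum_insert) auto

text \<open>The third power is spanned by a nonzero \<open>s\<close>, which the maximal ideal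
  annihilates because the fourth power vanishes. A one-dimensional socle therefore consists of the
  multiples of \<open>s\<close>.\<close>

lemma short_gorenstein_canonically_graded:
  assumes char: "(2 :: 'k) \<noteq> 0" and one: "\<one> \<notin> \<mm>"
    and unit: "\<And>y. y \<in> \<mm> \<Longrightarrow> \<one> \<ominus> y \<in> Units A"
    and artinian: "artinian_ring A"
    and socle: "vectorspace.dim class_ring (socle A \<mm>) = 1"
    and H2: "hilbert_function class_ring A \<mm> 2 = CARD('n)"
    and H3: "hilbert_function class_ring A \<mm> 3 = 1"
    and H4: "hilbert_function class_ring A \<mm> 4 = 0"
  shows "canonically_graded class_ring A \<mm>"
proof -
  have P4: "P 4 = {\<zero>}"
    by (rule stable_power_zero[OF artinian unit hilbert_zero[OF H4]]) auto
  obtain b where b: "\<forall>i\<in>UNIV. b i \<in> P 2"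
    "\<forall>a\<in>P 2. \<exists>c. a \<ominus> (\<Oplus>j\<in>(UNIV :: 'n set). c j \<odot> b j) \<in> P (Suc 2)"
    "\<forall>c. (\<Oplus>j\<in>(UNIV :: 'n set). c j \<odot> b j) \<in> P (Suc 2) \<longrightarrow> (\<forall>j\<in>UNIV. c j = 0)"
    using hilbert_basis[of "UNIV :: 'n set" 2, OF finite H2] by (elim exE conjE)
  \<comment> \<open>The one-point index set reduces a basis to a single element; the socle is
    treated the same way below.\<close>
  have "hilbert_function class_ring A \<mm> 3 = card {()}" using H3 by simp
  then obtain b' where b': "\<forall>s\<in>{()}. b' s \<in> P 3"
    "\<forall>a\<in>P 3. \<exists>c. a \<ominus> (\<Oplus>j\<in>{()}. c j \<odot> b' j) \<in> P (Suc 3)"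
    "\<forall>c. (\<Oplus>j\<in>{()}. c j \<odot> b' j) \<in> P (Suc 3) \<longrightarrow> (\<forall>s\<in>{()}. c s = 0)"
    using hilbert_basis[of "{()}" 3] by auto
  define s where "s = b' ()"
  have s3: "s \<in> P 3" using b'(1) by (simp add: s_def)
  have sc [simp]: "s \<in> carrier A" using s3 by (rule P_carrier)
  have sum: "(\<Oplus>j\<in>{()}. c j \<odot> b' j) = c () \<odot> s" for c
    unfolding s_def using sc[unfolded s_def] by (intro finsum_singleton_unit) simp
  have Suc3: "P (Suc 3) = {\<zero>}" using P4 by (simp add: numeral_eq_Suc)
  have s_span: "\<exists>d. a = d \<odot> s" if a: "a \<in> P 3" for a
  proof -
    obtain c where "a \<ominus> c () \<odot> s = \<zero>" using bspec[OF b'(2) a] unfolding sum Suc3 by blast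
    then have "a = c () \<odot> s" using P_carrier[OF a] by simp
    then show ?thesis by blast
  qed
  have s0: "s \<noteq> \<zero>" using spec[OF b'(3), of "\<lambda>_. 1"] unfolding sum Suc3 by auto
  let ?W = "{a \<in> carrier A. \<forall>y\<in>\<mm>. a \<otimes> y = \<zero>}"
  have sW: "s \<in> ?W"
  proof -
    have "s \<otimes> y = \<zero>" if "y \<in> \<mm>" for y
      using P_mult[OF s3, of y "Suc 0"] that P_one Suc3 by simp
    then show ?thesis by simp
  qed
  have soc: "socle A \<mm> = A\<lparr>carrier := ?W\<rparr>" by (simp add: socle_def)
  interpret V: vectorspace class_ring A by (rule algebra_vectorspace)
  interpret W: vectorspace class_ring "A\<lparr>carrier := ?W\<rparr>"
    by (rule vectorspace_restrict[OF socle_submodule])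
  have fd: "W.fin_dim" by (rule V.submodule_fin_dim[OF fin_dim[OF P4] socle_submodule])
  have "card {()} = W.dim" using socle soc by simp
  from W.basis_family[OF fd _ this, OF finite]
  obtain t' where t': "t' \<in> {()} \<rightarrow> carrier (A\<lparr>carrier := ?W\<rparr>)"
    "\<forall>v\<in>carrier (A\<lparr>carrier := ?W\<rparr>). \<exists>c\<in>{()} \<rightarrow> carrier class_ring.
      v = (\<Oplus>\<^bsub>A\<lparr>carrier := ?W\<rparr>\<^esub>i\<in>{()}. c i \<odot>\<^bsub>A\<lparr>carrier := ?W\<rparr>\<^esub> t' i)"
    by (elim exE conjE)
  define t where "t = t' ()"
  have tW: "t \<in> ?W" using t'(1) by (auto simp: t_def)
  then have tc [simp]: "t \<in> carrier A" by simp
  have W_span: "\<exists>c. v = c \<odot> t" if v: "v \<in> ?W" for v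
  proof -
    have v': "v \<in> carrier (A\<lparr>carrier := ?W\<rparr>)" using v by simp
    obtain c where c: "v = (\<Oplus>\<^bsub>A\<lparr>carrier := ?W\<rparr>\<^esub>i\<in>{()}. c i \<odot>\<^bsub>A\<lparr>carrier := ?W\<rparr>\<^esub> t' i)"
      using bspec[OF t'(2) v'] by (elim bexE)
    have "c () \<odot> t \<in> ?W" using submodule_closed(2)[OF socle_submodule tW] .
    then have "(\<Oplus>\<^bsub>A\<lparr>carrier := ?W\<rparr>\<^esub>i\<in>{()}. c i \<odot>\<^bsub>A\<lparr>carrier := ?W\<rparr>\<^esub> t' i) = c () \<odot> t"
      unfolding t_def by (subst W.M.finsum_insert) auto
    then show ?thesis using c by blast
  qed
  have socle_P3: "a \<in> P 3" if a: "a \<in> carrier A" "\<And>y. y \<in> \<mm> \<Longrightarrow> a \<otimes> y = \<zero>" for a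
  proof -
    have "a \<in> ?W" using a by simp
    then obtain l where l: "a = l \<odot> t" using W_span by blast
    obtain k where k: "s = k \<odot> t" using W_span[OF sW] by blast
    \<comment> \<open>Both \<open>a\<close> and \<open>s\<close> are multiples of the socle
      generator \<open>t\<close>; as \<open>s\<close> is nonzero its coefficient can be
      inverted.\<close>
    have "k \<noteq> 0" using s0 k by auto
    then have "a = (l / k) \<odot> s" unfolding k l by (simp add: K_smult_assoc[symmetric])
    then show ?thesis using P_closed(5)[OF s3] by simp
  qed
  have S23: "Suc 2 = 3" by simp
  have "short_gorenstein A \<mm> x b s"
  proof unfold_locales
    show "b i \<in> P 2" for i using b(1) by simp
    show "\<exists>c. a \<ominus> (\<Oplus>j\<in>UNIV. c j \<odot> b j) \<in> P 3" if "a \<in> P 2" for a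
      using bspec[OF b(2) that] by (simp only: S23)
    show "c j = 0" if "(\<Oplus>j\<in>UNIV. c j \<odot> b j) \<in> P 3" for c j
      using spec[OF b(3), of c] that by (simp only: S23) blast
  qed (use char P4 one s3 s_span s0 socle_P3 in auto)
  then show ?thesis by (rule short_gorenstein.canonically_graded)
qed

end

section \<open>Local quotients of the power series ring\<close>

context field_algebra
begin

lemma quot_alg_finsum:
  assumes J: "ideal J A" and "finite S" "\<And>s. s \<in> S \<Longrightarrow> f s \<in> carrier A"
  shows "(\<Oplus>\<^bsub>quot_alg A J\<^esub>s\<in>S. J +> f s) = J +> (\<Oplus>s\<in>S. f s)"
  using assms(2,3)
proof (induction rule: finite_induct)
  case empty
  interpret Q: field_algebra "quot_alg A J" by (rule quot_alg_field_algebra[OF J])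
  show ?case using coset_eq_zero_iff[OF J, of \<zero>] ideal_zero[OF J] by simp
next
  case (insert t S)
  interpret Q: field_algebra "quot_alg A J" by (rule quot_alg_field_algebra[OF J])
  have "(\<Oplus>\<^bsub>quot_alg A J\<^esub>s\<in>insert t S. J +> f s) =
      (J +> f t) \<oplus>\<^bsub>quot_alg A J\<^esub> (\<Oplus>\<^bsub>quot_alg A J\<^esub>s\<in>S. J +> f s)"
    using insert by (intro Q.M.finsum_insert) (auto simp only: quot_alg_carrier)
  moreover have "(\<Oplus>s\<in>insert t S. f s) = f t \<oplus> (\<Oplus>s\<in>S. f s)"
    using insert by (intro M.finsum_insert) auto
  moreover have "(\<Oplus>s\<in>S. f s) \<in> carrier A" using insert by (intro M.finsum_closed) auto
  ultimately show ?case using insert quot_alg_add[OF J, of "f t" "\<Oplus>s\<in>S. f s"] by simp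
qed

end

interpretation PS: field_algebra "power_series :: ('k::field, ('n::finite \<Rightarrow> nat) \<Rightarrow> 'k) module"
  unfolding field_algebra_def by (rule power_series_algebra)

lemma constant_term_mult:
  fixes f g :: "('n::finite \<Rightarrow> nat) \<Rightarrow> 'k::field"
  shows "(f \<otimes>\<^bsub>power_series\<^esub> g) (\<lambda>i. 0) = f (\<lambda>i. 0) * g (\<lambda>i. 0)"
proof -
  have "{p. (\<lambda>i::'n. fst p i + snd p i) = (\<lambda>i. 0 :: nat)} = {(\<lambda>i. 0, \<lambda>i. 0)}"
    by (auto simp: fun_eq_iff prod_eq_iff)
  then show ?thesis unfolding power_series_mult by simp
qed

locale local_series_quotient =
  fixes I :: "(('n::finite \<Rightarrow> nat) \<Rightarrow> 'k::field) set" and \<mm>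
  assumes ideal_I: "ideal I power_series"
    and local: "local_ring (quot_alg power_series I) \<mm>"
begin

abbreviation A :: "('k, (('n \<Rightarrow> nat) \<Rightarrow> 'k) set) module" where
  "A \<equiv> quot_alg power_series I"

abbreviation cl :: "(('n \<Rightarrow> nat) \<Rightarrow> 'k) \<Rightarrow> (('n \<Rightarrow> nat) \<Rightarrow> 'k) set" where
  "cl f \<equiv> I +>\<^bsub>power_series\<^esub> f"

sublocale A: field_algebra A
  by (rule PS.quot_alg_field_algebra[OF ideal_I])

lemma carrier_A: "carrier A = range cl"
  using PS.quot_alg_carrier[of I] by simp

lemma cl_carrier: "cl f \<in> carrier A"
  unfolding carrier_A by simp

lemma cl_mult: "cl f \<otimes>\<^bsub>A\<^esub> cl g = cl (f \<otimes>\<^bsub>power_series\<^esub> g)"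
  by (rule PS.quot_alg_mult[OF ideal_I]) simp_all

lemma cl_add: "cl f \<oplus>\<^bsub>A\<^esub> cl g = cl (\<lambda>e. f e + g e)"
  using PS.quot_alg_add[OF ideal_I, of f g] by simp

lemma cl_smult: "c \<odot>\<^bsub>A\<^esub> cl f = cl (\<lambda>e. c * f e)"
  using PS.quot_alg_smult[OF ideal_I, of f c] by simp

lemma cl_one: "\<one>\<^bsub>A\<^esub> = cl \<one>\<^bsub>power_series\<^esub>"
  by (simp only: quot_alg_fields)

lemma cl_minus: "\<ominus>\<^bsub>A\<^esub> cl f = cl (\<lambda>e. - f e)"
  using A.K_smult_l_minus[OF cl_carrier, of 1 f] A.K_smult_one[OF cl_carrier] cl_smult[of "-1" f] by simp

lemma cl_diff: "cl f \<ominus>\<^bsub>A\<^esub> cl g = cl (\<lambda>e. f e - g e)"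
  unfolding a_minus_def cl_minus cl_add by simp

lemma cl_unit:
  assumes "f (\<lambda>i. 0) \<noteq> 0"
  shows "cl f \<in> Units A"
proof -
  have "cl f \<otimes>\<^bsub>A\<^esub> cl (series_inv f) = \<one>\<^bsub>A\<^esub>"
    unfolding cl_mult cl_one power_series_inverse[of f, OF assms] ..
  then show ?thesis
    using A.m_comm[OF cl_carrier cl_carrier, of f "series_inv f"] cl_carrier unfolding Units_def by auto
qed

text \<open>The candidate for the maximal ideal. Membership only asks for some representative
  without constant term; that this is a proper ideal of the quotient depends on the quotient being
  local and is shown in \<open>maximal_ideal_eq\<close>.\<close>

definition M :: "(('n \<Rightarrow> nat) \<Rightarrow> 'k) set set" where
  "M = cl ` {f. f (\<lambda>i. 0) = 0}"

lemma ideal_M: "ideal M A"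
proof (rule idealI)
  show "subgroup M (add_monoid A)"
  proof (rule A.M.add.subgroupI)
    show "M \<subseteq> carrier A" using cl_carrier by (auto simp: M_def)
    show "M \<noteq> {}" by (auto simp: M_def intro: exI[of _ "\<lambda>e. 0"])
  next
    fix X assume "X \<in> M"
    then obtain f where f: "X = cl f" "f (\<lambda>i. 0) = 0" by (auto simp: M_def)
    show "\<ominus>\<^bsub>A\<^esub> X \<in> M" unfolding f(1) cl_minus M_def by (rule imageI) (simp add: f)
    fix Y assume "Y \<in> M"
    then obtain g where g: "Y = cl g" "g (\<lambda>i. 0) = 0" by (auto simp: M_def)
    show "X \<oplus>\<^bsub>A\<^esub> Y \<in> M" unfolding f(1) g(1) cl_add M_def by (rule imageI) (simp add: f g)
  qed
next
  fix X Y assume "X \<in> M" and Y: "Y \<in> carrier A"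
  then obtain f where f: "X = cl f" "f (\<lambda>i. 0) = 0" by (auto simp: M_def)
  obtain g where g: "Y = cl g" using Y unfolding carrier_A by blast
  show "Y \<otimes>\<^bsub>A\<^esub> X \<in> M" unfolding f(1) g cl_mult M_def by (rule imageI) (simp add: f constant_term_mult)
  show "X \<otimes>\<^bsub>A\<^esub> Y \<in> M" unfolding f(1) g cl_mult M_def by (rule imageI) (simp add: f constant_term_mult)
qed (rule A.ring_axioms)

lemma maximal: "maximalideal \<mm> A"
  using local_ring.unique_maximalideal[OF local, of \<mm>] by simp

lemma ideal_m: "ideal \<mm> A"
  using maximal by (rule maximalideal.axioms)

lemma one_notin: "\<one>\<^bsub>A\<^esub> \<notin> \<mm>"
  using maximalideal.I_notcarr[OF maximal] ideal.one_imp_carrier[OF ideal_m] by metis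

lemma unit_notin:
  assumes "X \<in> \<mm>"
  shows "X \<notin> Units A"
proof
  assume X: "X \<in> Units A"
  then have "X \<otimes>\<^bsub>A\<^esub> inv\<^bsub>A\<^esub> X \<in> \<mm>"
    using ideal.I_r_closed[OF ideal_m assms] A.Units_inv_closed by blast
  then show False using one_notin A.Units_r_inv[OF X] by simp
qed

text \<open>A series with nonzero constant term has a unit as its class, so \<open>\<mm>\<close>,
  which contains no unit, is contained in \<open>M\<close>. Since \<open>M\<close> is proper,
  maximality of \<open>\<mm>\<close> gives equality.\<close>

lemma maximal_ideal_eq: "\<mm> = M"
proof -
  have sub: "\<mm> \<subseteq> M"
  proof
    fix X assume X: "X \<in> \<mm>"
    obtain f where f: "X = cl f" using ideal.Icarr[OF ideal_m X] unfolding carrier_A by blast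
    then have "f (\<lambda>i. 0) = 0" using cl_unit unit_notin[OF X] by blast
    then show "X \<in> M" using f by (simp add: M_def)
  qed
  have "\<one>\<^bsub>A\<^esub> \<notin> M"
  proof
    assume "\<one>\<^bsub>A\<^esub> \<in> M"
    then obtain f where f: "cl \<one>\<^bsub>power_series\<^esub> = cl f" "f (\<lambda>i. 0) = 0"
      unfolding cl_one M_def by blast
    \<comment> \<open>If 1 and a series without constant term had the same class, their difference,
      with constant term 1, would be both zero and a unit in the quotient, whereas zero belongs to
      \<open>\<mm>\<close>.\<close>
    have "cl (\<lambda>e. \<one>\<^bsub>power_series\<^esub> e - f e) = \<zero>\<^bsub>A\<^esub>"
      unfolding cl_diff[symmetric] f(1) by (simp only: a_minus_def A.M.r_neg[OF cl_carrier])
    moreover have "cl (\<lambda>e. \<one>\<^bsub>power_series\<^esub> e - f e) \<in> Units A"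
      by (rule cl_unit) (simp add: f)
    ultimately show False using unit_notin A.ideal_zero[OF ideal_m] by metis
  qed
  then have "M \<noteq> carrier A" using A.one_closed by metis
  moreover have "M \<subseteq> carrier A" using cl_carrier by (auto simp: M_def)
  ultimately show ?thesis using maximalideal.I_maximal[OF maximal ideal_M sub] by blast
qed

lemma one_minus_unit: "X \<in> \<mm> \<Longrightarrow> \<one>\<^bsub>A\<^esub> \<ominus>\<^bsub>A\<^esub> X \<in> Units A"
  unfolding maximal_ideal_eq M_def cl_one by (auto simp only: cl_diff intro!: cl_unit) simp

lemma generated: "generated_adic_algebra A \<mm> (\<lambda>i. cl (series_var i))"
proof (intro generated_adic_algebra.intro generated_adic_algebra_axioms.intro adic_algebra.intro
    adic_algebra_axioms.intro ideal_m A.field_algebra_axioms)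
  fix i
  show "cl (series_var i) \<in> \<mm>"
    unfolding maximal_ideal_eq M_def by (rule imageI) (auto simp: series_var_def fun_eq_iff)
next
  fix X assume "X \<in> \<mm>"
  then obtain f where f: "X = cl f" "f (\<lambda>i. 0) = 0" unfolding maximal_ideal_eq M_def by blast
  obtain g where "f = (\<Oplus>\<^bsub>power_series\<^esub>i\<in>UNIV. series_var i \<otimes>\<^bsub>power_series\<^esub> g i)"
    using power_series_no_constant_term[of f, OF f(2)] by blast
  then have "X = (\<Oplus>\<^bsub>A\<^esub>i\<in>UNIV. cl (series_var i) \<otimes>\<^bsub>A\<^esub> cl (g i))"
    unfolding f(1) cl_mult by (subst PS.quot_alg_finsum[OF ideal_I]) simp_all
  then show "\<exists>g. (\<forall>i. g i \<in> carrier A) \<and> X = (\<Oplus>\<^bsub>A\<^esub>i\<in>UNIV. cl (series_var i) \<otimes>\<^bsub>A\<^esub> g i)"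
    using cl_carrier by (intro exI[of _ "\<lambda>i. cl (g i)"]) blast
next
  fix X assume "X \<in> carrier A"
  then obtain f where f: "X = cl f" unfolding carrier_A by blast
  have "X \<ominus>\<^bsub>A\<^esub> f (\<lambda>i. 0) \<odot>\<^bsub>A\<^esub> \<one>\<^bsub>A\<^esub> \<in> \<mm>"
    unfolding f cl_one cl_smult cl_diff maximal_ideal_eq M_def by (rule imageI) simp
  then show "\<exists>c. X \<ominus>\<^bsub>A\<^esub> c \<odot>\<^bsub>A\<^esub> \<one>\<^bsub>A\<^esub> \<in> \<mm>" by blast
qed

end

theorem theorem3p3:
  fixes I :: "(('n::finite \<Rightarrow> nat) \<Rightarrow> 'k::{alg_closed_field, field_char_0}) set"
    and A :: "('k, (('n \<Rightarrow> nat) \<Rightarrow> 'k) set) module"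
    and \<mm> :: "(('n \<Rightarrow> nat) \<Rightarrow> 'k) set set"
  assumes "ideal I power_series"
    and "A = quot_alg power_series I"
    and "artinian_gorenstein class_ring A \<mm>"
    and "\<And>i. hilbert_function class_ring A \<mm> i =
               (if i < 4 then [1, CARD('n), CARD('n), 1] ! i else 0)"
  shows "canonically_graded class_ring A \<mm>"
proof -
  have gor: "artinian_ring A" "local_ring A \<mm>" "vectorspace.dim class_ring (socle A \<mm>) = 1"
    using assms(3) by (simp_all add: artinian_gorenstein_def)
  interpret Q: local_series_quotient I \<mm>
    by (rule local_series_quotient.intro) (use assms(1) gor(2) in \<open>simp_all only: assms(2)\<close>)
  \<comment> \<open>The interpretation speaks of the explicit quotient; folding restores the name
    \<open>A\<close> of the statement.\<close>
  note * = generated_adic_algebra.short_gorenstein_canonically_graded[OF Q.generated, folded assms(2)]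
  show ?thesis
  proof (rule *)
    show "hilbert_function class_ring A \<mm> 2 = CARD('n)" "hilbert_function class_ring A \<mm> 3 = 1"
      "hilbert_function class_ring A \<mm> 4 = 0"
      using assms(4)[of 2] assms(4)[of 3] assms(4)[of 4] by (simp_all add: numeral_eq_Suc)
    show "\<one>\<^bsub>A\<^esub> \<notin> \<mm>" unfolding assms(2) by (rule Q.one_notin)
    show "\<one>\<^bsub>A\<^esub> \<ominus>\<^bsub>A\<^esub> y \<in> Units A" if "y \<in> \<mm>" for y
      unfolding assms(2) using that by (rule Q.one_minus_unit)
  qed (use gor in simp_all)
qed

end
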